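(* Let $\mathcal{R}$ be an expansion of $(\mathbb{R},<,+)$ that does not define $\mathcal{B}$. Let $f: \mathbb{R} \to \mathbb{R}$ be a continuous $\mathcal{R}$-definable function. Then there is an $\mathcal{R}$-definable open dense set $U \subseteq \mathbb{R}$ such that $f$ is strictly increasing, strictly decreasing, or constant on every connected component of $U$. Moreover, there is an open dense subset $V$ of $\mathbb{R}$ such that $f$ is either constant or locally bi-Lipschitz on each connected component of $V$.
   Context: A function $f$ is bi-Lipschitz on a set $X \subseteq \mathbb{R}$ if there is a real $\lambda > 0$ such that $\frac{1}{\lambda}|x-y| \leq |f(x)-f(y)| \leq \lambda|x-y|$ for all $x,y\in X$; $f$ is locally bi-Lipschitz on an open set if every point of that set has a neighbourhood on which $f$ is bi-Lipschitz. $\mathcal{B}$ denotes the two-sorted first order structure $(\mathcal{P}(\mathbb{N}),\mathbb{N},\in,+1)$, where $\mathcal{P}(\mathbb{N})$ is the power set of $\mathbb{N}$, $\in$ is the membership relation between $\mathbb{N}$ and $\mathcal{P}(\mathbb{N})$, and $+1$ is the successor function on $\mathbb{N}$. "Definable" means first order definable with parameters. A structure with underlying set $\mathbb{R}$ "defines $\mathcal{B}$" if it defines an isomorphic copy of $\mathcal{B}$: there are definable sets $N', P'$ (subsets of Cartesian powers of $\mathbb{R}$), a definable relation $\epsilon \subseteq N' \times P'$ and a definable function $s: N' \to N'$ such that the two-sorted structure $(P',N',\epsilon,s)$ is isomorphic to $\mathcal{B}$. *)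

theory Defs
  imports "HOL-Analysis.Analysis"
begin

text \<open>
  First-order logic with equality over an arbitrary one-sorted language. Variables are de Bruijn
  indices: \<open>Exi\<close> binds index 0 and shifts the remaining variables up by one.
\<close>

datatype 'f tm = Var nat | Fn 'f "'f tm list"

datatype ('f, 'r) fm =
    Eql "'f tm" "'f tm"
  | Rl 'r "'f tm list"
  | Neg "('f, 'r) fm"
  | Conj "('f, 'r) fm" "('f, 'r) fm"
  | Exi "('f, 'r) fm"

text \<open>
  A structure with underlying set the whole type \<open>'a\<close>. The symbols of its language are those with
  arity \<open>Some k\<close> (so a language may lack function or relation symbols altogether). The values
  of an interpretation outside the language or at lists of the wrong length are irrelevant,
  because only well-formed formulas are used below.
\<close>

record ('f, 'r, 'a) fo_structure =
  fun_arity :: "'f \<Rightarrow> nat option"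
  rel_arity :: "'r \<Rightarrow> nat option"
  fun_interp :: "'f \<Rightarrow> 'a list \<Rightarrow> 'a"
  rel_interp :: "'r \<Rightarrow> 'a list \<Rightarrow> bool"

fun wf_tm :: "('f, 'r, 'a) fo_structure \<Rightarrow> 'f tm \<Rightarrow> bool" where
  "wf_tm M (Var i) \<longleftrightarrow> True"
| "wf_tm M (Fn f ts) \<longleftrightarrow> fun_arity M f = Some (length ts) \<and> (\<forall>t\<in>set ts. wf_tm M t)"

fun wf_fm :: "('f, 'r, 'a) fo_structure \<Rightarrow> ('f, 'r) fm \<Rightarrow> bool" where
  "wf_fm M (Eql t u) \<longleftrightarrow> wf_tm M t \<and> wf_tm M u"
| "wf_fm M (Rl r ts) \<longleftrightarrow> rel_arity M r = Some (length ts) \<and> (\<forall>t\<in>set ts. wf_tm M t)"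
| "wf_fm M (Neg \<phi>) \<longleftrightarrow> wf_fm M \<phi>"
| "wf_fm M (Conj \<phi> \<psi>) \<longleftrightarrow> wf_fm M \<phi> \<and> wf_fm M \<psi>"
| "wf_fm M (Exi \<phi>) \<longleftrightarrow> wf_fm M \<phi>"

fun tm_val :: "('f, 'r, 'a) fo_structure \<Rightarrow> (nat \<Rightarrow> 'a) \<Rightarrow> 'f tm \<Rightarrow> 'a" where
  "tm_val M e (Var i) = e i"
| "tm_val M e (Fn f ts) = fun_interp M f (map (tm_val M e) ts)"

fun sat :: "('f, 'r, 'a) fo_structure \<Rightarrow> (nat \<Rightarrow> 'a) \<Rightarrow> ('f, 'r) fm \<Rightarrow> bool" where
  "sat M e (Eql t u) \<longleftrightarrow> tm_val M e t = tm_val M e u"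
| "sat M e (Rl r ts) \<longleftrightarrow> rel_interp M r (map (tm_val M e) ts)"
| "sat M e (Neg \<phi>) \<longleftrightarrow> \<not> sat M e \<phi>"
| "sat M e (Conj \<phi> \<psi>) \<longleftrightarrow> sat M e \<phi> \<and> sat M e \<psi>"
| "sat M e (Exi \<phi>) \<longleftrightarrow> (\<exists>a. sat M (case_nat a e) \<phi>)"

text \<open>
  The \<open>n\<close>-th Cartesian power of the underlying set is the set of lists of length \<open>n\<close>.
  Variables \<open>0, \<dots>, n - 1\<close> stand for the coordinates and variable \<open>n + j\<close> for the parameter
  \<open>p j\<close>; a formula mentions only finitely many of these parameters.
\<close>

definition definable :: "('f, 'r, 'a) fo_structure \<Rightarrow> nat \<Rightarrow> 'a list set \<Rightarrow> bool" where
  "definable M n X \<longleftrightarrow>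
     (\<exists>\<phi> p. wf_fm M \<phi> \<and>
        X = {xs. length xs = n \<and> sat M (\<lambda>i. if i < n then xs ! i else p (i - n)) \<phi>})"

definition definable_set1 :: "('f, 'r, 'a) fo_structure \<Rightarrow> 'a set \<Rightarrow> bool" where
  "definable_set1 M X \<longleftrightarrow> definable M 1 {[x] | x. x \<in> X}"

definition definable_fun1 :: "('f, 'r, 'a) fo_structure \<Rightarrow> ('a \<Rightarrow> 'a) \<Rightarrow> bool" where
  "definable_fun1 M f \<longleftrightarrow> definable M 2 {[x, f x] | x. True}"

definition expands_real_order_add :: "('f, 'r, real) fo_structure \<Rightarrow> bool" where
  "expands_real_order_add M \<longleftrightarrow>
     (\<exists>r. rel_arity M r = Some 2 \<and> (\<forall>x y. rel_interp M r [x, y] \<longleftrightarrow> x < y)) \<and>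
     (\<exists>f. fun_arity M f = Some 2 \<and> (\<forall>x y. fun_interp M f [x, y] = x + y))"

text \<open>
  Two-sorted structures \<open>(P, N, E, s)\<close> with a relation \<open>E \<subseteq> N \<times> P\<close> and a function \<open>s\<close> from
  \<open>N\<close> to \<open>N\<close>; values of \<open>s\<close> outside \<open>N\<close> are irrelevant.
\<close>

record ('p, 'n) two_sorted =
  psort :: "'p set"
  nsort :: "'n set"
  mem_rel :: "('n \<times> 'p) set"
  succ_fun :: "'n \<Rightarrow> 'n"

definition two_sorted_iso :: "('p, 'n) two_sorted \<Rightarrow> ('q, 'm) two_sorted \<Rightarrow> bool" where
  "two_sorted_iso A B \<longleftrightarrow>
     (\<exists>h g. bij_betw h (psort A) (psort B) \<and> bij_betw g (nsort A) (nsort B) \<and>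
        (\<forall>x\<in>nsort A. \<forall>y\<in>psort A. (x, y) \<in> mem_rel A \<longleftrightarrow> (g x, h y) \<in> mem_rel B) \<and>
        (\<forall>x\<in>nsort A. g (succ_fun A x) = succ_fun B (g x)))"

definition B_structure :: "(nat set, nat) two_sorted" where
  "B_structure = \<lparr>psort = UNIV, nsort = UNIV, mem_rel = {(n, A). n \<in> A}, succ_fun = Suc\<rparr>"

definition defines_B :: "('f, 'r, 'a) fo_structure \<Rightarrow> bool" where
  "defines_B M \<longleftrightarrow>
     (\<exists>k l P N E s.
        definable M k P \<and> definable M l N \<and>
        E \<subseteq> N \<times> P \<and> definable M (l + k) {x @ y | x y. (x, y) \<in> E} \<and>
        s \<in> N \<rightarrow> N \<and> definable M (l + l) {x @ s x | x. x \<in> N} \<and>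
        two_sorted_iso \<lparr>psort = P, nsort = N, mem_rel = E, succ_fun = s\<rparr> B_structure)"

definition bi_lipschitz_on :: "real set \<Rightarrow> (real \<Rightarrow> real) \<Rightarrow> bool" where
  "bi_lipschitz_on X f \<longleftrightarrow>
     (\<exists>c>0. \<forall>x\<in>X. \<forall>y\<in>X. 1 / c * \<bar>x - y\<bar> \<le> \<bar>f x - f y\<bar> \<and> \<bar>f x - f y\<bar> \<le> c * \<bar>x - y\<bar>)"

definition locally_bi_lipschitz_on :: "real set \<Rightarrow> (real \<Rightarrow> real) \<Rightarrow> bool" where
  "locally_bi_lipschitz_on U f \<longleftrightarrow>
     (\<forall>x\<in>U. \<exists>W. open W \<and> x \<in> W \<and> W \<subseteq> U \<and> bi_lipschitz_on W f)"

end

theory Submission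
  imports Defs
begin

text \<open>
  The idea is that a function which violates the conclusion carries infinitely many bits of
  definable discrete information, spread densely over an interval, and that this is enough to
  code arbitrary subsets of \<open>\<nat>\<close> by reals.

  The discrete information takes the form of a \<^emph>\<open>tower\<close>: a definable family of finite sets of
  reals that increases as its positive real index tends to 0. If the union of a tower is dense in
  an interval, the structure defines \<open>\<B>\<close> (\<open>dense_tower_defines_B\<close>). The index ranks the points of the
  union. The best approximations from the left of a suitably chosen real form a definable sequence
  that is as sparse as desired in this ranking; they represent \<open>\<nat>\<close>. Each of them determines a finite
  set of points of smaller or equal rank, and a real codes a set of natural numbers by its position
  with respect to these finite sets, one bit at each level.

  For the first claim, local maxima of \<open>f\<close>, counted with the radius of the interval on which they
  are maximal, form a tower. So do local minima. If \<open>f\<close> is not monotone on any subinterval of an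
  interval, their union is dense there. Hence every interval contains one on which \<open>f\<close> is monotone
  (\<open>monotone_somewhere\<close>), and therefore a point near which \<open>f\<close> is strictly monotone or constant.

  For the second claim it suffices to show that an increasing definable continuous function \<open>h\<close> is
  Lipschitz on some subinterval (\<open>lipschitz_somewhere\<close>), since this applies to the inverse function as
  well. Suppose that it is not. If some tower grows forever, the indices at which it grows form a
  definable set of scales tending to 0; the local extrema of \<open>x \<mapsto> h (x + \<epsilon>) - h x\<close> for these scales
  \<open>\<epsilon>\<close> are then dense, because monotone increments make \<open>h\<close> Lipschitz, and \<open>\<B>\<close> is definable. If all
  towers stabilise, definable closed bounded sets of reals are as simple as in an o-minimal
  structure. In that case the points can be ordered by the germs of the increments of \<open>h\<close>. Below a
  point whose increments \<open>h (y + t) - h y\<close> are at most \<open>C * t\<close> for small \<open>t\<close> there are only finitely many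
  points, so that for every \<open>C\<close> there are at most countably many points of this kind. But for large
  \<open>C\<close> there are uncountably many, such as the last points where \<open>h x - C * x\<close> takes a given value.
\<close>

section \<open>Definable predicates on environments\<close>

fun ren_tm :: "(nat \<Rightarrow> nat) \<Rightarrow> 'f tm \<Rightarrow> 'f tm" where
  "ren_tm \<rho> (Var i) = Var (\<rho> i)"
| "ren_tm \<rho> (Fn f ts) = Fn f (map (ren_tm \<rho>) ts)"

fun ren_fm :: "(nat \<Rightarrow> nat) \<Rightarrow> ('f, 'r) fm \<Rightarrow> ('f, 'r) fm" where
  "ren_fm \<rho> (Eql t u) = Eql (ren_tm \<rho> t) (ren_tm \<rho> u)"
| "ren_fm \<rho> (Rl r ts) = Rl r (map (ren_tm \<rho>) ts)"
| "ren_fm \<rho> (Neg \<phi>) = Neg (ren_fm \<rho> \<phi>)"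
| "ren_fm \<rho> (Conj \<phi> \<psi>) = Conj (ren_fm \<rho> \<phi>) (ren_fm \<rho> \<psi>)"
| "ren_fm \<rho> (Exi \<phi>) = Exi (ren_fm (case_nat 0 (\<lambda>i. Suc (\<rho> i))) \<phi>)"

lemma wf_ren_tm [simp]: "wf_tm M (ren_tm \<rho> t) \<longleftrightarrow> wf_tm M t"
  by (induction t) auto

lemma wf_ren_fm [simp]: "wf_fm M (ren_fm \<rho> \<phi>) \<longleftrightarrow> wf_fm M \<phi>"
  by (induction \<phi> arbitrary: \<rho>) auto

lemma tm_val_ren [simp]: "tm_val M e (ren_tm \<rho> t) = tm_val M (\<lambda>i. e (\<rho> i)) t"
  by (induction t) (auto intro!: arg_cong[where f = "fun_interp M _"])

lemma sat_ren [simp]: "sat M e (ren_fm \<rho> \<phi>) \<longleftrightarrow> sat M (\<lambda>i. e (\<rho> i)) \<phi>"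
proof (induction \<phi> arbitrary: \<rho> e)
  case (Rl r ts)
  then show ?case by (auto simp: comp_def)
next
  case (Exi \<phi>)
  have "(\<lambda>i. case_nat a e (case_nat 0 (\<lambda>i. Suc (\<rho> i)) i)) = case_nat a (\<lambda>i. e (\<rho> i))" for a
    by (auto split: nat.splits)
  then show ?case by (simp add: Exi)
qed auto

text \<open>
  A definable relation is a predicate on all environments \<open>nat \<Rightarrow> 'a\<close>, so that arity never has to be
  tracked. The map \<open>v\<close> lets each variable of \<open>\<phi>\<close> stand either for a coordinate or for a parameter;
  formulas with different parameters can then be combined by renaming variables only. The closure
  rules below mirror the connectives, which makes definability of an explicit HOL formula a matter
  of applying introduction rules.
\<close>
definition definable_pred :: "('f, 'r, 'a) fo_structure \<Rightarrow> ((nat \<Rightarrow> 'a) \<Rightarrow> bool) \<Rightarrow> bool" where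
  "definable_pred M Q \<longleftrightarrow>
     (\<exists>\<phi> v. wf_fm M \<phi> \<and> (\<forall>e. Q e \<longleftrightarrow> sat M (\<lambda>i. case v i of Inl j \<Rightarrow> e j | Inr c \<Rightarrow> c) \<phi>))"

definition definable_term :: "('f, 'r, 'a) fo_structure \<Rightarrow> ((nat \<Rightarrow> 'a) \<Rightarrow> 'a) \<Rightarrow> bool" where
  "definable_term M t \<longleftrightarrow> definable_pred M (\<lambda>e. e 0 = t (\<lambda>i. e (Suc i)))"

lemma definable_pred_sat:
  assumes "wf_fm M \<phi>"
  shows "definable_pred M (\<lambda>e. sat M (\<lambda>i. case v i of Inl j \<Rightarrow> e j | Inr c \<Rightarrow> c) \<phi>)"
  using assms unfolding definable_pred_def by blast

lemma definable_pred_rename: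
  assumes "definable_pred M Q"
  shows "definable_pred M (\<lambda>e. Q (\<lambda>i. e (\<rho> i)))"
proof -
  obtain \<phi> v where \<phi>: "wf_fm M \<phi>"
    "\<And>e. Q e \<longleftrightarrow> sat M (\<lambda>i. case v i of Inl j \<Rightarrow> e j | Inr c \<Rightarrow> c) \<phi>"
    using assms unfolding definable_pred_def by blast
  have "Q (\<lambda>i. e (\<rho> i)) \<longleftrightarrow> sat M (\<lambda>i. case (case v i of Inl j \<Rightarrow> Inl (\<rho> j) | Inr c \<Rightarrow> Inr c)
          of Inl j \<Rightarrow> e j | Inr c \<Rightarrow> c) \<phi>" for e
    unfolding \<phi>(2) by (rule arg_cong[where f = "\<lambda>e. sat M e \<phi>"]) (auto split: sum.splits)
  then show ?thesis
    unfolding definable_pred_def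
    by (intro exI[of _ \<phi>] exI[of _ "\<lambda>i. case v i of Inl j \<Rightarrow> Inl (\<rho> j) | Inr c \<Rightarrow> Inr c"])
       (use \<phi>(1) in simp)
qed

lemma definable_pred_not:
  assumes "definable_pred M Q"
  shows "definable_pred M (\<lambda>e. \<not> Q e)"
proof -
  obtain \<phi> v where "wf_fm M \<phi>"
    "\<And>e. Q e \<longleftrightarrow> sat M (\<lambda>i. case v i of Inl j \<Rightarrow> e j | Inr c \<Rightarrow> c) \<phi>"
    using assms unfolding definable_pred_def by blast
  then have "wf_fm M (Neg \<phi>)"
    "\<And>e. \<not> Q e \<longleftrightarrow> sat M (\<lambda>i. case v i of Inl j \<Rightarrow> e j | Inr c \<Rightarrow> c) (Neg \<phi>)"
    by auto
  then show ?thesis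
    unfolding definable_pred_def by blast
qed

lemma definable_pred_conj:
  assumes "definable_pred M Q" "definable_pred M Q'"
  shows "definable_pred M (\<lambda>e. Q e \<and> Q' e)"
proof -
  obtain \<phi> v where \<phi>: "wf_fm M \<phi>"
    "\<And>e. Q e \<longleftrightarrow> sat M (\<lambda>i. case v i of Inl j \<Rightarrow> e j | Inr c \<Rightarrow> c) \<phi>"
    using assms(1) unfolding definable_pred_def by blast
  obtain \<psi> w where \<psi>: "wf_fm M \<psi>"
    "\<And>e. Q' e \<longleftrightarrow> sat M (\<lambda>i. case w i of Inl j \<Rightarrow> e j | Inr c \<Rightarrow> c) \<psi>"
    using assms(2) unfolding definable_pred_def by blast
  \<comment> \<open>The variables of the two formulas are made disjoint: even ones and odd ones.\<close>
  define u where "u i = (if even i then v (i div 2) else w (i div 2))" for i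
  define \<theta> where "\<theta> = Conj (ren_fm (\<lambda>i. 2 * i) \<phi>) (ren_fm (\<lambda>i. 2 * i + 1) \<psi>)"
  have "Q e \<and> Q' e \<longleftrightarrow> sat M (\<lambda>i. case u i of Inl j \<Rightarrow> e j | Inr c \<Rightarrow> c) \<theta>" for e
    unfolding \<theta>_def by (simp add: u_def \<phi>(2) \<psi>(2))
  moreover have "wf_fm M \<theta>"
    using \<phi>(1) \<psi>(1) by (simp add: \<theta>_def)
  ultimately show ?thesis
    unfolding definable_pred_def by blast
qed

text \<open>
  In the premise the witness has become coordinate 0 and the old coordinates have moved up by one.
\<close>
lemma definable_pred_ex:
  assumes "definable_pred M (\<lambda>e. Q (\<lambda>i. e (Suc i)) (e 0))"
  shows "definable_pred M (\<lambda>e. \<exists>a. Q e a)"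
proof -
  obtain \<phi> v where \<phi>: "wf_fm M \<phi>"
    "\<And>e. Q (\<lambda>i. e (Suc i)) (e 0) \<longleftrightarrow> sat M (\<lambda>i. case v i of Inl j \<Rightarrow> e j | Inr c \<Rightarrow> c) \<phi>"
    using assms(1) unfolding definable_pred_def by blast
  \<comment> \<open>Every formula variable that stands for coordinate 0 is identified with the bound one.\<close>
  define \<rho> where "\<rho> i = (if v i = Inl 0 then 0 else Suc i)" for i
  define w where "w i = (case v i of Inl j \<Rightarrow> Inl (j - 1) | Inr c \<Rightarrow> Inr c)" for i
  have "sat M (case_nat a (\<lambda>i. case w i of Inl j \<Rightarrow> e j | Inr c \<Rightarrow> c)) (ren_fm \<rho> \<phi>) \<longleftrightarrow> Q e a"
    for e a
  proof -
    have "(\<lambda>i. case_nat a (\<lambda>i. case w i of Inl j \<Rightarrow> e j | Inr c \<Rightarrow> c) (\<rho> i))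
        = (\<lambda>i. case v i of Inl j \<Rightarrow> case_nat a e j | Inr c \<Rightarrow> c)"
      by (auto simp: \<rho>_def w_def split: sum.splits nat.splits)
    then show ?thesis
      using \<phi>(2)[of "case_nat a e"] by simp
  qed
  then have "(\<exists>a. Q e a) \<longleftrightarrow> sat M (\<lambda>i. case w i of Inl j \<Rightarrow> e j | Inr c \<Rightarrow> c) (Exi (ren_fm \<rho> \<phi>))"
    for e by simp
  moreover have "wf_fm M (Exi (ren_fm \<rho> \<phi>))"
    using \<phi>(1) by simp
  ultimately show ?thesis
    unfolding definable_pred_def by blast
qed

lemma definable_pred_disj:
  assumes "definable_pred M Q" "definable_pred M Q'"
  shows "definable_pred M (\<lambda>e. Q e \<or> Q' e)"
  using definable_pred_not[OF definable_pred_conj[OF assms[THEN definable_pred_not]]] by simp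

lemma definable_pred_imp:
  assumes "definable_pred M Q" "definable_pred M Q'"
  shows "definable_pred M (\<lambda>e. Q e \<longrightarrow> Q' e)"
  using definable_pred_disj[OF definable_pred_not[OF assms(1)] assms(2)] by (simp only: imp_conv_disj)

lemma definable_pred_all:
  assumes "definable_pred M (\<lambda>e. Q (\<lambda>i. e (Suc i)) (e 0))"
  shows "definable_pred M (\<lambda>e. \<forall>a. Q e a)"
  using definable_pred_not[OF definable_pred_ex[OF definable_pred_not[OF assms]]] by simp

lemma definable_pred_eq_vars: "definable_pred M (\<lambda>e. e i = e j)"
  using definable_pred_sat[of M "Eql (Var 0) (Var 1)" "\<lambda>n. if n = 0 then Inl i else Inl j"] by simp

lemma definable_term_var: "definable_term M (\<lambda>e. e i)"
  unfolding definable_term_def by (rule definable_pred_eq_vars)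

lemma definable_term_const: "definable_term M (\<lambda>e. c)"
  unfolding definable_term_def
  using definable_pred_sat[of M "Eql (Var 0) (Var 1)" "\<lambda>n. if n = 0 then Inl 0 else Inr c"] by simp

lemma definable_pred_subst1:
  assumes "definable_pred M (\<lambda>e. A (e 0))" "definable_term M t"
  shows "definable_pred M (\<lambda>e. A (t e))"
proof -
  have "definable_pred M (\<lambda>e. \<exists>x. x = t e \<and> A x)"
    using assms by (intro definable_pred_ex definable_pred_conj) (simp_all add: definable_term_def)
  then show ?thesis by simp
qed

lemma definable_pred_subst2:
  assumes "definable_pred M (\<lambda>e. A (e 0) (e 1))" "definable_term M t" "definable_term M u"
  shows "definable_pred M (\<lambda>e. A (t e) (u e))"
proof -
  have A: "definable_pred M (\<lambda>e. A (e 1) (e 0))"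
    using definable_pred_rename[OF assms(1), of "\<lambda>i. if i = 0 then 1 else 0"] by simp
  have t: "definable_pred M (\<lambda>e. e 1 = t (\<lambda>i. e (Suc (Suc i))))"
    using definable_pred_rename[OF assms(2)[unfolded definable_term_def], of "Suc"] by simp
  have u: "definable_pred M (\<lambda>e. e 0 = u (\<lambda>i. e (Suc (Suc i))))"
    using definable_pred_rename[OF assms(3)[unfolded definable_term_def],
        of "\<lambda>i. if i = 0 then 0 else Suc i"] by simp
  have "definable_pred M (\<lambda>e. \<exists>x y. x = t e \<and> y = u e \<and> A x y)"
    using A t u by (intro definable_pred_ex definable_pred_conj) simp_all
  then show ?thesis by simp
qed

lemma definable_pred_mem:
  assumes "definable_pred M (\<lambda>e. e 0 \<in> X)" "definable_term M t"
  shows "definable_pred M (\<lambda>e. t e \<in> X)"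
  by (rule definable_pred_subst1[where A = "\<lambda>x. x \<in> X", OF assms])

lemma definable_pred_mem_family:
  assumes "definable_pred M (\<lambda>e. e 1 \<in> F (e 0))" "definable_term M t" "definable_term M u"
  shows "definable_pred M (\<lambda>e. u e \<in> F (t e))"
  by (rule definable_pred_subst2[where A = "\<lambda>i x. x \<in> F i", OF assms])

lemma definable_pred_eq:
  assumes "definable_term M t" "definable_term M u"
  shows "definable_pred M (\<lambda>e. t e = u e)"
  using definable_pred_subst2[OF _ assms, of "(=)"] definable_pred_eq_vars by blast

lemma definable_term_app:
  assumes "definable_pred M (\<lambda>e. e 0 = f (e 1))" "definable_term M t"
  shows "definable_term M (\<lambda>e. f (t e))"
proof -
  have t: "definable_term M (\<lambda>e. t (\<lambda>i. e (Suc i)))"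
    unfolding definable_term_def
    using definable_pred_rename[OF assms(2)[unfolded definable_term_def],
        of "\<lambda>i. if i = 0 then 0 else Suc i"] by simp
  show ?thesis
    unfolding definable_term_def
    by (rule definable_pred_subst2[OF assms(1) definable_term_var t])
qed

lemma definable_term_app2:
  assumes "definable_pred M (\<lambda>e. e 0 = g (e 1) (e 2))" "definable_term M t" "definable_term M u"
  shows "definable_term M (\<lambda>e. g (t e) (u e))"
proof -
  have shift: "definable_pred M (\<lambda>e. e i = s (\<lambda>i. e (Suc (Suc (Suc i)))))"
    if "definable_term M s" for s i
    using definable_pred_rename[OF that[unfolded definable_term_def],
        of "\<lambda>j. if j = 0 then i else Suc (Suc j)"] by simp
  have g: "definable_pred M (\<lambda>e. e 2 = g (e 1) (e 0))"
    using definable_pred_rename[OF assms(1), of "\<lambda>i. if i = 0 then 2 else if i = 1 then 1 else 0"]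
    by simp
  have "definable_pred M (\<lambda>e. \<exists>x y. x = t (\<lambda>i. e (Suc i)) \<and> y = u (\<lambda>i. e (Suc i)) \<and> e 0 = g x y)"
    using g shift[OF assms(2)] shift[OF assms(3)]
    by (intro definable_pred_ex definable_pred_conj) (simp_all add: numeral_2_eq_2)
  then show ?thesis
    unfolding definable_term_def by simp
qed

text \<open>
  Coordinates from \<open>n\<close> on become parameters with the arbitrary value \<open>d\<close>.
\<close>
lemma definable_if_definable_pred:
  fixes Q :: "(nat \<Rightarrow> 'a) \<Rightarrow> bool"
  assumes "definable_pred M Q" and X: "X = {xs. length xs = n \<and> Q (\<lambda>i. if i < n then xs ! i else d)}"
  shows "definable M n X"
proof -
  obtain \<phi> v where \<phi>: "wf_fm M \<phi>"
    "\<And>e. Q e \<longleftrightarrow> sat M (\<lambda>i. case v i of Inl j \<Rightarrow> e j | Inr c \<Rightarrow> c) \<phi>"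
    using assms(1) unfolding definable_pred_def by blast
  define \<rho> where "\<rho> i = (case v i of Inl j \<Rightarrow> if j < n then j else n + i | Inr c \<Rightarrow> n + i)" for i
  define p where "p i = (case v i of Inl j \<Rightarrow> d | Inr c \<Rightarrow> c)" for i
  have "sat M (\<lambda>i. if i < n then xs ! i else p (i - n)) (ren_fm \<rho> \<phi>)
      \<longleftrightarrow> Q (\<lambda>i. if i < n then xs ! i else d)" for xs
    unfolding \<phi>(2) sat_ren
    by (rule arg_cong[where f = "\<lambda>e. sat M e \<phi>"]) (auto simp: \<rho>_def p_def split: sum.splits)
  then show ?thesis
    unfolding definable_def X using \<phi>(1) wf_ren_fm by blast
qed

lemma definable_singletons:
  assumes "definable_pred M (\<lambda>e. e 0 \<in> X)"
  shows "definable M 1 {[x] | x. x \<in> X}"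
  by (rule definable_if_definable_pred[OF assms])
     (auto simp: length_Suc_conv)

lemma definable_pairs:
  assumes "definable_pred M (\<lambda>e. A (e 0) (e 1))"
  shows "definable M 2 {[x, y] | x y. A x y}"
  by (rule definable_if_definable_pred[OF assms])
     (auto simp: length_Suc_conv numeral_2_eq_2)

lemma definable_pred_fun1:
  fixes f :: "'a \<Rightarrow> 'a"
  assumes "definable_fun1 M f"
  shows "definable_pred M (\<lambda>e. e 0 = f (e 1))"
proof -
  obtain \<phi> p where \<phi>: "wf_fm M \<phi>"
    "{[x, f x] | x. True} = {xs. length xs = 2 \<and> sat M (\<lambda>i. if i < 2 then xs ! i else p (i - 2)) \<phi>}"
    using assms unfolding definable_fun1_def definable_def by blast
  define v :: "nat \<Rightarrow> nat + 'a" where "v i = (if i = 0 then Inl 1 else if i = 1 then Inl 0 else Inr (p (i - 2)))" for i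
  have "e 0 = f (e 1) \<longleftrightarrow> sat M (\<lambda>i. case v i of Inl j \<Rightarrow> e j | Inr c \<Rightarrow> c) \<phi>" for e
  proof -
    have "e 0 = f (e 1) \<longleftrightarrow> [e 1, e 0] \<in> {[x, f x] | x. True}" by auto
    also have "\<dots> \<longleftrightarrow> sat M (\<lambda>i. if i < 2 then [e 1, e 0] ! i else p (i - 2)) \<phi>"
      unfolding \<phi>(2) by (simp del: One_nat_def)
    also have "(\<lambda>i. if i < 2 then [e 1, e 0] ! i else p (i - 2))
        = (\<lambda>i. case v i of Inl j \<Rightarrow> e j | Inr c \<Rightarrow> c)"
      by (auto simp: v_def fun_eq_iff less_2_cases_iff)
    finally show ?thesis .
  qed
  then show ?thesis
    using \<phi>(1) unfolding definable_pred_def by blast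
qed

locale real_group_expansion =
  fixes R :: "('f, 'r, real) fo_structure"
  assumes expands: "expands_real_order_add R"
begin

abbreviation dpred :: "((nat \<Rightarrow> real) \<Rightarrow> bool) \<Rightarrow> bool" where
  "dpred \<equiv> definable_pred R"

abbreviation dterm :: "((nat \<Rightarrow> real) \<Rightarrow> real) \<Rightarrow> bool" where
  "dterm \<equiv> definable_term R"

lemma dpred_less:
  assumes "dterm t" "dterm u"
  shows "dpred (\<lambda>e. t e < u e)"
proof -
  obtain r where r: "rel_arity R r = Some 2" "\<And>x y. rel_interp R r [x, y] \<longleftrightarrow> x < y"
    using expands unfolding expands_real_order_add_def by blast
  have "dpred (\<lambda>e. e 0 < e 1)"
    using definable_pred_sat[of R "Rl r [Var 0, Var 1]" Inl] r by simp
  from definable_pred_subst2[OF this assms] show ?thesis .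
qed

lemma dpred_le:
  assumes "dterm t" "dterm u"
  shows "dpred (\<lambda>e. t e \<le> u e)"
  using definable_pred_not[OF dpred_less[OF assms(2,1)]] by (simp add: not_less)

lemma dterm_add:
  assumes "dterm t" "dterm u"
  shows "dterm (\<lambda>e. t e + u e)"
proof -
  obtain f where f: "fun_arity R f = Some 2" "\<And>x y. fun_interp R f [x, y] = x + y"
    using expands unfolding expands_real_order_add_def by blast
  have "dpred (\<lambda>e. e 0 = e 1 + e 2)"
    using definable_pred_sat[of R "Eql (Var 0) (Fn f [Var 1, Var 2])" Inl] f by simp
  from definable_term_app2[OF this assms] show ?thesis .
qed

lemma dterm_diff:
  assumes "dterm t" "dterm u"
  shows "dterm (\<lambda>e. t e - u e)"
proof -
  have "dpred (\<lambda>e. e 0 + e 2 = e 1)"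
    by (intro definable_pred_eq dterm_add definable_term_var)
  then have "dpred (\<lambda>e. e 0 = e 1 - e 2)"
    by (simp add: eq_diff_eq)
  from definable_term_app2[OF this assms] show ?thesis .
qed

lemma dterm_uminus:
  assumes "dterm t"
  shows "dterm (\<lambda>e. - t e)"
  using dterm_diff[OF definable_term_const assms, of 0] by simp

lemmas definable_intros =
  definable_pred_ex definable_pred_all definable_pred_conj definable_pred_disj definable_pred_imp
  definable_pred_not definable_pred_eq dpred_less dpred_le
  definable_term_var definable_term_const dterm_add dterm_diff dterm_uminus

end

section \<open>Coding all subsets of the natural numbers\<close>

text \<open>
  A subset \<open>A\<close> of \<open>\<nat>\<close> is coded by one real through an increasing sequence of finite sets \<open>E k\<close>. The
  real \<open>c\<close> is approached from the left by its predecessors \<open>l k\<close> in \<open>E k\<close>, and \<open>l (Suc k)\<close> is the first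
  or the second point of \<open>E (Suc k)\<close> above \<open>l k\<close>; the second one says that \<open>k \<in> A\<close>. This reading needs
  nothing but the order and the sets \<open>E k\<close>.
\<close>
definition is_pred :: "real set \<Rightarrow> real \<Rightarrow> real \<Rightarrow> bool" where
  "is_pred S x l \<longleftrightarrow> l \<in> S \<and> l < x \<and> (\<forall>y. y \<in> S \<longrightarrow> y < x \<longrightarrow> y \<le> l)"

definition is_next :: "real set \<Rightarrow> real \<Rightarrow> real \<Rightarrow> bool" where
  "is_next S l z \<longleftrightarrow> z \<in> S \<and> l < z \<and> (\<forall>y. y \<in> S \<longrightarrow> l < y \<longrightarrow> z \<le> y)"

definition is_next2 :: "real set \<Rightarrow> real \<Rightarrow> real \<Rightarrow> bool" where
  "is_next2 S l z \<longleftrightarrow> (\<exists>y. is_next S l y \<and> is_next S y z)"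

lemma is_pred_unique: "is_pred S x l \<Longrightarrow> is_pred S x l' \<Longrightarrow> l = l'"
  unfolding is_pred_def by (meson order_antisym)

lemma is_next_unique: "is_next S l z \<Longrightarrow> is_next S l z' \<Longrightarrow> z = z'"
  unfolding is_next_def by (meson order_antisym)

lemma is_next2_unique: "is_next2 S l z \<Longrightarrow> is_next2 S l z' \<Longrightarrow> z = z'"
  unfolding is_next2_def by (metis is_next_unique)

lemma is_next_not_next2: "is_next S l z \<Longrightarrow> \<not> is_next2 S l z"
  unfolding is_next2_def is_next_def by (meson leD less_trans)

lemma is_next_exists:
  assumes "finite S" "y \<in> S" "l < y"
  obtains z where "is_next S l z" "z \<le> y"
proof -
  let ?A = "{x \<in> S. l < x}"
  have "finite ?A" "?A \<noteq> {}" using assms by auto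
  then have "is_next S l (Min ?A)" "Min ?A \<le> y"
    using assms Min_in[of ?A] by (auto simp: is_next_def)
  then show thesis by (rule that)
qed

lemma gap_right_of_point:
  fixes d :: real
  assumes "finite S" "d < v"
  obtains w where "d < w" "w < v" "{d<..<w} \<inter> S = {}"
proof (cases "\<exists>y\<in>S. d < y")
  case True
  then obtain z where z: "is_next S d z"
    using assms(1) is_next_exists by blast
  obtain w where "d < w" "w < min z v"
    using z assms(2) dense[of d "min z v"] by (auto simp: is_next_def)
  then show thesis
    using z by (intro that[of w]) (force simp: is_next_def)+
next
  case False
  obtain w where "d < w" "w < v" using assms(2) dense by blast
  then show thesis using False by (intro that[of w]) force+
qed

text \<open>
  Three intermediate points are what branching needs: two possible left end points, and a right
  end point that stays strictly inside the old cell even if the second one is chosen.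
\<close>
definition separates :: "real set \<Rightarrow> real set \<Rightarrow> bool" where
  "separates S S' \<longleftrightarrow>
     (\<forall>l\<in>S. \<forall>r\<in>S. l < r \<longrightarrow> (\<exists>x\<in>S'. \<exists>y\<in>S'. \<exists>z\<in>S'. l < x \<and> x < y \<and> y < z \<and> z < r))"

locale branching_levels =
  fixes E :: "nat \<Rightarrow> real set" and u w :: real
  assumes fin: "finite (E k)"
    and sep: "separates (E k) (E (Suc k))"
    and dense: "u \<le> p \<Longrightarrow> p < q \<Longrightarrow> q \<le> w \<Longrightarrow> \<exists>k. \<exists>x\<in>E k. p < x \<and> x < q"
    and start: "u \<in> E 0" "is_next (E 0) u w"
begin

definition codes :: "real set" where
  "codes = {c. is_pred (E 0) c u \<and> c \<le> w \<and>
     (\<forall>k. \<exists>l l'. is_pred (E k) c l \<and> is_pred (E (Suc k)) c l' \<and>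
        (is_next (E (Suc k)) l l' \<or> is_next2 (E (Suc k)) l l'))}"

definition bits :: "real \<Rightarrow> nat set" where
  "bits c = {k. \<exists>l l'. is_pred (E k) c l \<and> is_pred (E (Suc k)) c l' \<and> is_next2 (E (Suc k)) l l'}"

text \<open>
  The bits determine the predecessor of a code in every level, and the levels are jointly dense, so
  they leave room for one code only. Hence codes need no further choice of representatives.
\<close>
lemma bits_inj: "inj_on bits codes"
proof (rule inj_onI)
  fix c c' assume c: "c \<in> codes" and c': "c' \<in> codes" and eq: "bits c = bits c'"
  \<comment> \<open>The codes are in the same cell of every level.\<close>
  have same: "\<exists>l. is_pred (E k) c l \<and> is_pred (E k) c' l" for k
  proof (induction k)
    case 0
    then show ?case using c c' unfolding codes_def by blast
  next
    case (Suc k)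
    then obtain l where l: "is_pred (E k) c l" "is_pred (E k) c' l" by blast
    obtain m where m: "is_pred (E (Suc k)) c m"
      "is_next (E (Suc k)) l m \<or> is_next2 (E (Suc k)) l m"
      using c l(1) is_pred_unique unfolding codes_def by blast
    obtain m' where m': "is_pred (E (Suc k)) c' m'"
      "is_next (E (Suc k)) l m' \<or> is_next2 (E (Suc k)) l m'"
      using c' l(2) is_pred_unique unfolding codes_def by blast
    have "k \<in> bits c \<longleftrightarrow> is_next2 (E (Suc k)) l m"
      unfolding bits_def using l m(1) by (auto dest: is_pred_unique)
    moreover have "k \<in> bits c' \<longleftrightarrow> is_next2 (E (Suc k)) l m'"
      unfolding bits_def using l m'(1) by (auto dest: is_pred_unique)
    ultimately have "m = m'"
      using eq m(2) m'(2) by (metis is_next_unique is_next2_unique)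
    then show ?case using m(1) m'(1) by blast
  qed
  \<comment> \<open>A point of some level between them would give different predecessors.\<close>
  have "\<not> x < y" if x: "x \<in> codes" and y: "y \<in> codes"
    and xy: "\<And>k. \<exists>l. is_pred (E k) x l \<and> is_pred (E k) y l" for x y
  proof
    assume "x < y"
    then obtain k z where z: "z \<in> E k" "x < z" "z < y"
      using x y dense[of x y] by (auto simp: codes_def is_pred_def)
    then show False
      using xy[of k] by (fastforce simp: is_pred_def)
  qed
  from this[OF c c'] this[OF c' c] same show "c = c'"
    by (metis linorder_neqE)
qed

lemma refine_cell:
  assumes "l \<in> E k" "is_next (E k) l r"
  shows "\<exists>l' r'. (if b then is_next2 (E (Suc k)) l l' else is_next (E (Suc k)) l l') \<and>
           l' \<in> E (Suc k) \<and> is_next (E (Suc k)) l' r' \<and> l < l' \<and> r' < r"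
proof -
  obtain x y z where xyz: "x \<in> E (Suc k)" "y \<in> E (Suc k)" "z \<in> E (Suc k)"
    "l < x" "x < y" "y < z" "z < r"
    using sep[of k] assms unfolding separates_def is_next_def by blast
  obtain z1 where z1: "is_next (E (Suc k)) l z1" "z1 \<le> x"
    using is_next_exists[OF fin xyz(1,4)] by blast
  moreover obtain z2 where z2: "is_next (E (Suc k)) z1 z2" "z2 \<le> y"
    using is_next_exists[OF fin xyz(2), of z1] z1(2) xyz by auto
  moreover obtain z3 where z3: "is_next (E (Suc k)) z2 z3" "z3 \<le> z"
    using is_next_exists[OF fin xyz(3), of z2] z2(2) xyz by auto
  ultimately have "is_next2 (E (Suc k)) l z2" "l < z1" "l < z2" "z2 < r" "z3 < r"
    "z1 \<in> E (Suc k)" "z2 \<in> E (Suc k)"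
    using xyz by (auto simp: is_next2_def is_next_def)
  then show ?thesis
    using z1 z2 z3 by (cases b) auto
qed

text \<open>
  Following \<open>A\<close> gives nested cells \<open>(l k, r k)\<close> whose end points move strictly inwards; the supremum
  of the \<open>l k\<close> therefore lies inside all of them, and \<open>l k\<close> is its predecessor in \<open>E k\<close>.
\<close>
lemma bits_surj: "\<exists>c\<in>codes. bits c = A"
proof -
  let ?P = "\<lambda>k s. fst s \<in> E k \<and> is_next (E k) (fst s) (snd s) \<and> (k = 0 \<longrightarrow> s = (u, w))"
  let ?Q = "\<lambda>k s s'. (if k \<in> A then is_next2 (E (Suc k)) (fst s) (fst s')
                      else is_next (E (Suc k)) (fst s) (fst s')) \<and>
                     fst s < fst s' \<and> snd s' < snd s"
  have "\<exists>s. \<forall>k. ?P k (s k) \<and> ?Q k (s k) (s (Suc k))"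
  proof (rule dependent_nat_choice)
    show "\<exists>s. ?P 0 s"
      using start by (intro exI[of _ "(u, w)"]) auto
  next
    fix s k assume "?P k s"
    then obtain l' r' where "(if k \<in> A then is_next2 (E (Suc k)) (fst s) l'
        else is_next (E (Suc k)) (fst s) l')" "l' \<in> E (Suc k)" "is_next (E (Suc k)) l' r'"
      "fst s < l'" "r' < snd s"
      using refine_cell[of "fst s" k "snd s" "k \<in> A"] by blast
    then show "\<exists>s'. ?P (Suc k) s' \<and> ?Q k s s'"
      by (intro exI[of _ "(l', r')"]) simp
  qed
  then obtain s where s: "\<And>k. ?P k (s k)" "\<And>k. ?Q k (s k) (s (Suc k))" by blast
  define l r where "l k = fst (s k)" and "r k = snd (s k)" for k
  have l: "l k \<in> E k" and lr: "is_next (E k) (l k) (r k)" for k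
    using s(1)[of k] by (auto simp: l_def r_def)
  have step: "if k \<in> A then is_next2 (E (Suc k)) (l k) (l (Suc k))
              else is_next (E (Suc k)) (l k) (l (Suc k))" for k
    using s(2)[of k] by (auto simp: l_def)
  have "strict_mono l" "strict_mono (\<lambda>k. - r k)"
    using s(2) by (auto simp: l_def r_def strict_mono_Suc_iff)
  then have l_mono: "l i \<le> l j" and r_mono: "r j \<le> r i" if "i \<le> j" for i j
    using that by (metis strict_mono_less_eq neg_le_iff_le)+
  have "l i < r j" for i j
  proof -
    have "l i \<le> l (max i j)" "l (max i j) < r (max i j)" "r (max i j) \<le> r j"
      using l_mono r_mono lr by (auto simp: is_next_def)
    then show ?thesis by linarith
  qed
  then have lr_less: "\<And>i j. l i < r j" .
  define c where "c = Sup (range l)"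
  have bdd: "bdd_above (range l)"
    using lr_less[of _ 0] by (intro bdd_aboveI[of _ "r 0"]) (auto intro: less_imp_le)
  have "l k < c" for k
  proof -
    have "l k < l (Suc k)" using \<open>strict_mono l\<close> by (simp add: strict_monoD)
    also have "\<dots> \<le> c" unfolding c_def using bdd by (intro cSup_upper) auto
    finally show ?thesis .
  qed
  have "c < r k" for k
  proof -
    have "c \<le> r (Suc k)"
      unfolding c_def using lr_less by (intro cSup_least) (auto intro: less_imp_le)
    also have "\<dots> < r k" using s(2)[of k] by (simp add: r_def)
    finally show ?thesis .
  qed
  have pred: "is_pred (E k) c (l k)" for k
    using \<open>\<And>k. l k < c\<close>[of k] \<open>\<And>k. c < r k\<close>[of k] l[of k] lr[of k]
    unfolding is_pred_def is_next_def by (meson less_le_trans not_le_imp_less order.asym)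
  have 0: "l 0 = u" "r 0 = w"
    using s(1)[of 0] by (auto simp: l_def r_def)
  have "c \<in> codes"
    unfolding codes_def
  proof (intro CollectI conjI allI)
    show "is_pred (E 0) c u" using pred[of 0] 0 by simp
    show "c \<le> w" using \<open>c < r 0\<close> 0 by simp
    fix k
    have "is_next (E (Suc k)) (l k) (l (Suc k)) \<or> is_next2 (E (Suc k)) (l k) (l (Suc k))"
      using step[of k] by (auto split: if_splits)
    then show "\<exists>l l'. is_pred (E k) c l \<and> is_pred (E (Suc k)) c l' \<and>
        (is_next (E (Suc k)) l l' \<or> is_next2 (E (Suc k)) l l')"
      using pred by blast
  qed
  moreover have "k \<in> bits c \<longleftrightarrow> is_next2 (E (Suc k)) (l k) (l (Suc k))" for k
    unfolding bits_def using pred[of k] pred[of "Suc k"] by (auto dest: is_pred_unique)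
  then have "bits c = A"
    using step is_next_not_next2 by (metis (lifting) set_eqI)
  ultimately show ?thesis by blast
qed

lemma bits_bij: "bij_betw bits codes UNIV"
  using bits_inj bits_surj by (auto simp: bij_betw_def image_iff) metis

end

context real_group_expansion
begin

text \<open>
  Both sorts are realised by definable sets of reals, that is, by lists of length one.
\<close>
lemma defines_B_on_reals:
  assumes P: "dpred (\<lambda>e. e 0 \<in> P)" and N: "dpred (\<lambda>e. e 0 \<in> N)"
    and E: "dpred (\<lambda>e. E (e 0) (e 1))" and S: "dpred (\<lambda>e. S (e 0) (e 1))"
    and d: "bij_betw d (UNIV :: nat set) N"
    and SS: "\<And>k y. S (d k) y \<longleftrightarrow> y = d (Suc k)"
    and h: "bij_betw h P (UNIV :: nat set set)"
    and Eh: "\<And>k c. c \<in> P \<Longrightarrow> E (d k) c \<longleftrightarrow> k \<in> h c"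
  shows "defines_B R"
proof -
  define g where "g = the_inv_into UNIV d"
  have dN: "d k \<in> N" for k using d by (auto simp: bij_betw_def)
  have gd: "g (d k) = k" for k
    using d by (simp add: g_def bij_betw_def the_inv_into_f_f)
  have dg: "d (g x) = x" if "x \<in> N" for x
    using d that gd unfolding bij_betw_def by auto
  define P' N' where "P' = {[x] | x. x \<in> P}" and "N' = {[x] | x. x \<in> N}"
  define E' where "E' = {([x], [y]) | x y. x \<in> N \<and> y \<in> P \<and> E x y}"
  define s where "s xs = [d (Suc (g (hd xs)))]" for xs
  have "definable R 1 P'" "definable R 1 N'"
    unfolding P'_def N'_def by (intro definable_singletons P N)+
  moreover have "E' \<subseteq> N' \<times> P'" "s \<in> N' \<rightarrow> N'"
    using dN by (auto simp: E'_def N'_def P'_def s_def)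
  moreover have "definable R (1 + 1) {x @ y | x y. (x, y) \<in> E'}"
  proof -
    have "definable R 2 {[x, y] | x y. x \<in> N \<and> y \<in> P \<and> E x y}"
      by (intro definable_pairs definable_intros E definable_pred_mem[OF P]
          definable_pred_mem[OF N])
    also have "{[x, y] | x y. x \<in> N \<and> y \<in> P \<and> E x y} = {x @ y | x y. (x, y) \<in> E'}"
    proof (intro Collect_cong iffI)
      fix z assume "\<exists>x y. z = [x, y] \<and> x \<in> N \<and> y \<in> P \<and> E x y"
      then obtain x y where "z = [x] @ [y]" "([x], [y]) \<in> E'" by (auto simp: E'_def)
      then show "\<exists>x y. z = x @ y \<and> (x, y) \<in> E'" by blast
    qed (auto simp: E'_def)
    finally show ?thesis by (simp add: numeral_2_eq_2)
  qed
  moreover have "definable R (1 + 1) {x @ s x | x. x \<in> N'}"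
  proof -
    have "definable R 2 {[x, y] | x y. x \<in> N \<and> S x y}"
      by (intro definable_pairs definable_intros S definable_pred_mem[OF N])
    also have "{[x, y] | x y. x \<in> N \<and> S x y} = {x @ s x | x. x \<in> N'}"
    proof -
      have "S x y \<longleftrightarrow> y = d (Suc (g x))" if "x \<in> N" for x y
        using SS[of "g x"] dg[OF that] by simp
      then show ?thesis by (auto simp: N'_def s_def)
    qed
    finally show ?thesis by (simp add: numeral_2_eq_2)
  qed
  moreover have "two_sorted_iso \<lparr>psort = P', nsort = N', mem_rel = E', succ_fun = s\<rparr> B_structure"
  proof -
    have "bij_betw hd P' P" "bij_betw hd N' N"
      by (rule bij_betw_byWitness[where f' = "\<lambda>x. [x]"]; auto simp: P'_def N'_def)+
    moreover have "bij_betw g N UNIV"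
      using d unfolding g_def by (rule bij_betw_the_inv_into)
    ultimately have "bij_betw (h \<circ> hd) P' UNIV" "bij_betw (g \<circ> hd) N' UNIV"
      using h bij_betw_trans by blast+
    moreover have "(x, y) \<in> E' \<longleftrightarrow> (g \<circ> hd) x \<in> (h \<circ> hd) y" if xy': "x \<in> N'" "y \<in> P'" for x y
    proof -
      obtain x' y' where xy: "x = [x']" "y = [y']" "x' \<in> N" "y' \<in> P"
        using xy' by (auto simp: N'_def P'_def)
      then show ?thesis
        using Eh[of y' "g x'"] dg[of x'] by (auto simp: E'_def)
    qed
    moreover have "(g \<circ> hd) (s x) = Suc ((g \<circ> hd) x)" for x
      by (simp add: s_def gd)
    ultimately show ?thesis
      unfolding two_sorted_iso_def B_structure_def
      by (intro exI[of _ "h \<circ> hd"] exI[of _ "g \<circ> hd"]) simp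
  qed
  ultimately show ?thesis
    unfolding defines_B_def by blast
qed

text \<open>
  The form in which infinite discrete information occurs in definable sets: a definable family of
  finite sets that grows as its real index tends to 0. The union of a tower is countable, with
  points ranked by the index at which they appear.
\<close>
definition tower :: "(real \<Rightarrow> real set) \<Rightarrow> bool" where
  "tower F \<longleftrightarrow> dpred (\<lambda>e. e 1 \<in> F (e 0)) \<and> (\<forall>i>0. finite (F i)) \<and>
     (\<forall>i j. 0 < i \<longrightarrow> i \<le> j \<longrightarrow> F j \<subseteq> F i)"

lemma towerD:
  assumes "tower F"
  shows "dpred (\<lambda>e. e 1 \<in> F (e 0))" "0 < i \<Longrightarrow> finite (F i)" "0 < i \<Longrightarrow> i \<le> j \<Longrightarrow> F j \<subseteq> F i"
  using assms unfolding tower_def by auto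

lemma dpred_tower:
  assumes "tower F" "dterm t" "dterm u"
  shows "dpred (\<lambda>e. u e \<in> F (t e))"
  by (rule definable_pred_mem_family[OF towerD(1)[OF assms(1)] assms(2,3)])

end

text \<open>
  The union \<open>D\<close> of a dense tower, with the indices forgotten: \<open>G d\<close> is the finite set of the points that
  are ranked no later than \<open>d\<close>. Only this comparison of points is used for the coding.
\<close>
locale ranked_dense_set =
  fixes D :: "real set" and G :: "real \<Rightarrow> real set" and a b :: real
  assumes ab: "a < b" and D_sub: "D \<subseteq> {a<..<b}"
    and G_finite: "d \<in> D \<Longrightarrow> finite (G d)"
    and G_self: "d \<in> D \<Longrightarrow> d \<in> G d" and G_sub: "G d \<subseteq> D"
    and G_chain: "x \<in> D \<Longrightarrow> y \<in> D \<Longrightarrow> G x \<subseteq> G y \<or> G y \<subseteq> G x"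
    and D_dense: "a \<le> p \<Longrightarrow> p < q \<Longrightarrow> q \<le> b \<Longrightarrow> \<exists>x\<in>D. p < x \<and> x < q"
begin

lemma finite_subset_G:
  assumes "finite X" "X \<subseteq> D"
  shows "\<exists>d\<in>D. X \<subseteq> G d"
  using assms
proof (induction X)
  case empty
  then show ?case using D_dense[of a b] ab by auto
next
  case (insert x X)
  then obtain d where d: "d \<in> D" "X \<subseteq> G d" by auto
  moreover have "x \<in> D" using insert.prems by blast
  ultimately show ?case
    using G_self[of x] G_chain[of x d] by blast
qed

lemma separating_G:
  assumes "finite S" "S \<subseteq> D"
  shows "\<exists>d\<in>D. S \<subseteq> G d \<and> separates S (G d)"
proof -
  have "\<exists>X. finite X \<and> X \<subseteq> D \<and>
      (\<exists>x\<in>X. \<exists>y\<in>X. \<exists>z\<in>X. l < x \<and> x < y \<and> y < z \<and> z < r)"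
    if lr: "l \<in> S" "r \<in> S" "l < r" for l r
  proof -
    have *: "a < l" "r < b" using lr assms(2) D_sub by auto
    obtain x where x: "x \<in> D" "l < x" "x < r" using D_dense[of l r] lr * by auto
    obtain y where y: "y \<in> D" "x < y" "y < r" using D_dense[of x r] x * by auto
    obtain z where z: "z \<in> D" "y < z" "z < r" using D_dense[of y r] x y * by auto
    show ?thesis using x y z by (intro exI[of _ "{x, y, z}"]) auto
  qed
  then obtain X where X: "\<And>l r. \<lbrakk>l \<in> S; r \<in> S; l < r\<rbrakk> \<Longrightarrow> finite (X l r) \<and> X l r \<subseteq> D \<and>
      (\<exists>x\<in>X l r. \<exists>y\<in>X l r. \<exists>z\<in>X l r. l < x \<and> x < y \<and> y < z \<and> z < r)"
    by metis
  define Y where "Y = S \<union> (\<Union>l\<in>S. \<Union>r\<in>{r\<in>S. l < r}. X l r)"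
  have "finite Y" unfolding Y_def using X assms by auto
  moreover have "Y \<subseteq> D" unfolding Y_def using X assms by auto
  ultimately obtain d where d: "d \<in> D" "Y \<subseteq> G d" using finite_subset_G by blast
  have "separates S (G d)"
    unfolding separates_def
  proof (intro ballI impI)
    fix l r assume lr: "l \<in> S" "r \<in> S" "l < r"
    then have "X l r \<subseteq> G d" using d(2) unfolding Y_def by auto
    then show "\<exists>x\<in>G d. \<exists>y\<in>G d. \<exists>z\<in>G d. l < x \<and> x < y \<and> y < z \<and> z < r"
      using X[OF lr] by (meson subsetD)
  qed
  then show ?thesis using d unfolding Y_def by auto
qed

text \<open>
  In the pair \<open>(d, v)\<close>, \<open>d\<close> is the latest point of a sequence that increases to a real \<open>c\<close>, and \<open>v\<close> an
  upper bound kept for \<open>c\<close>. No point of rank at most that of \<open>d\<close> lies between \<open>d\<close> and \<open>v\<close>, so \<open>d\<close> will be a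
  best approximation of \<open>c\<close> from the left whatever is chosen later.
\<close>
definition good :: "real \<times> real \<Rightarrow> bool" where
  "good s \<longleftrightarrow> fst s \<in> D \<and> fst s < snd s \<and> snd s \<le> b \<and> {fst s<..<snd s} \<inter> G (fst s) = {}"

definition extends :: "real \<times> real \<Rightarrow> real \<times> real \<Rightarrow> bool" where
  "extends s s' \<longleftrightarrow> fst s < fst s' \<and> snd s' < snd s \<and> separates (G (fst s)) (G (fst s')) \<and>
     (\<forall>x\<in>D. fst s < x \<and> x < snd s' \<longrightarrow> G (fst s') \<subseteq> G x)"

text \<open>
  The next point is a point of least rank in an interval \<open>(d, w)\<close> so short that everything in it is
  ranked after a set that separates \<open>G d\<close>. Hence the sequence is as sparse as the coding requires.
\<close>
lemma extend_good:
  assumes "good s"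
  shows "\<exists>s'. good s' \<and> extends s s'"
proof -
  obtain d v where s: "s = (d, v)" by (cases s)
  have dv: "d \<in> D" "d < v" "v \<le> b" "{d<..<v} \<inter> G d = {}"
    using assms by (auto simp: good_def s)
  have "a < d" using dv(1) D_sub by auto
  obtain M where M: "M \<in> D" "G d \<subseteq> G M" "separates (G d) (G M)"
    using separating_G[of "G d"] G_finite G_sub dv(1) by blast
  obtain w where w: "d < w" "w < v" "{d<..<w} \<inter> G M = {}"
    using gap_right_of_point[OF G_finite[OF M(1)] dv(2)] by blast
  have "\<exists>x. x \<in> D \<and> d < x \<and> x < w" using D_dense[of d w] w dv \<open>a < d\<close> by auto
  \<comment> \<open>The sets \<open>G x\<close> form a chain of finite sets, so a point of least rank has the least cardinality.\<close>
  from ex_has_least_nat[of "\<lambda>x. x \<in> D \<and> d < x \<and> x < w", where m = "\<lambda>x. card (G x)"] this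
  obtain d' where d': "d' \<in> D" "d < d'" "d' < w"
    and least: "\<And>x. \<lbrakk>x \<in> D; d < x; x < w\<rbrakk> \<Longrightarrow> card (G d') \<le> card (G x)"
    by blast
  obtain v' where v': "d' < v'" "v' < w" "{d'<..<v'} \<inter> G d' = {}"
    using gap_right_of_point[OF G_finite[OF d'(1)] d'(3)] by blast
  have min: "G d' \<subseteq> G x" if "x \<in> D" "d < x" "x < v'" for x
    using G_chain[OF d'(1) that(1)] least[of x] that v'(2) card_seteq[OF G_finite[OF d'(1)], of "G x"]
    by auto
  have "d' \<notin> G M" using w(3) d' by auto
  then have "G M \<subseteq> G d'"
    using G_chain[OF M(1) d'(1)] G_self[OF d'(1)] by blast
  then have "separates (G d) (G d')"
    using M(3) unfolding separates_def by (meson subsetD)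
  then have "good (d', v') \<and> extends s (d', v')"
    using d' v' w dv min by (auto simp: good_def extends_def s)
  then show ?thesis by blast
qed

text \<open>
  Sparseness of the sequence \<open>d\<close> would not be of use if its range were not definable. It is, with the
  parameters \<open>d 0\<close> and \<open>c\<close>, because it consists of the best approximations of \<open>c\<close> from the left:
  points of \<open>D\<close> such that everything between them and \<open>c\<close> has a later rank.
\<close>
lemma sparse_sequence:
  obtains d :: "nat \<Rightarrow> real" and c u w :: real where
    "\<And>k. d k \<in> D" "strict_mono d"
    "\<And>x. x \<in> range d \<longleftrightarrow>
        x \<in> D \<and> d 0 \<le> x \<and> x < c \<and> (\<forall>y. y \<in> D \<longrightarrow> x < y \<longrightarrow> y < c \<longrightarrow> y \<notin> G x)"
    "branching_levels (\<lambda>k. G (d k)) u w"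
proof -
  obtain x where x: "x \<in> D" using D_dense[of a b] ab by auto
  obtain y where y: "y \<in> D" "x < y" using D_dense[of x b] x D_sub by force
  obtain M where M: "M \<in> D" "{x, y} \<subseteq> G M" using finite_subset_G[of "{x, y}"] x y by auto
  obtain v where v: "M < v" "v < b" "{M<..<v} \<inter> G M = {}"
    using gap_right_of_point[OF G_finite[OF M(1)], of M b] M D_sub by force
  have "\<exists>s. \<forall>k. (good (s k) \<and> (k = 0 \<longrightarrow> s k = (M, v))) \<and> extends (s k) (s (Suc k))"
  proof (rule dependent_nat_choice)
    show "\<exists>s. good s \<and> ((0::nat) = 0 \<longrightarrow> s = (M, v))"
      using M v by (intro exI[of _ "(M, v)"]) (auto simp: good_def)
  next
    fix s and k :: nat assume "good s \<and> (k = 0 \<longrightarrow> s = (M, v))"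
    then show "\<exists>s'. (good s' \<and> (Suc k = 0 \<longrightarrow> s' = (M, v))) \<and> extends s s'"
      using extend_good[of s] by auto
  qed
  then obtain s where s: "\<And>k. good (s k)" "s 0 = (M, v)" "\<And>k. extends (s k) (s (Suc k))"
    by blast
  define d v where "d k = fst (s k)" and "v k = snd (s k)" for k
  have good: "d k \<in> D" "d k < v k" "{d k<..<v k} \<inter> G (d k) = {}" for k
    using s(1)[of k] by (auto simp: good_def d_def v_def)
  have ext: "d k < d (Suc k)" "v (Suc k) < v k" "separates (G (d k)) (G (d (Suc k)))"
    "\<And>x. \<lbrakk>x \<in> D; d k < x; x < v (Suc k)\<rbrakk> \<Longrightarrow> G (d (Suc k)) \<subseteq> G x" for k
    using s(3)[of k] by (auto simp: extends_def d_def v_def)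
  have d_mono: "strict_mono d" and "strict_mono (\<lambda>k. - v k)"
    using ext by (auto simp: strict_mono_Suc_iff)
  then have d_le: "d i \<le> d j" and v_le: "v j \<le> v i" if "i \<le> j" for i j
    using that by (metis strict_mono_less_eq neg_le_iff_le)+
  have dv: "d i < v j" for i j
  proof -
    have "d i \<le> d (max i j)" "v (max i j) \<le> v j" using d_le v_le by auto
    then show ?thesis using good(2)[of "max i j"] by linarith
  qed
  define c where "c = Sup (range d)"
  have bdd: "bdd_above (range d)"
    using dv[of _ 0] by (intro bdd_aboveI[of _ "v 0"]) (auto intro: less_imp_le)
  have dc: "d k < c" for k
  proof -
    have "d (Suc k) \<le> c" unfolding c_def using bdd by (intro cSup_upper) auto
    then show ?thesis using ext(1)[of k] by simp
  qed
  have cv: "c < v k" for k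
  proof -
    have "c \<le> v (Suc k)"
      unfolding c_def using dv by (intro cSup_least) (auto intro: less_imp_le)
    then show ?thesis using ext(2)[of k] by simp
  qed
  have range: "x \<in> range d \<longleftrightarrow>
      x \<in> D \<and> d 0 \<le> x \<and> x < c \<and> (\<forall>y. y \<in> D \<longrightarrow> x < y \<longrightarrow> y < c \<longrightarrow> y \<notin> G x)" (is "_ \<longleftrightarrow> ?r x") for x
  proof
    assume "x \<in> range d"
    then obtain k where k: "x = d k" by auto
    have "y \<notin> G x" if "x < y" "y < c" for y
      using good(3)[of k] that cv[of k] k by force
    then show "?r x" using good(1) dc d_le[of 0 k] k by auto
  next
    assume r: "?r x"
    \<comment> \<open>The first \<open>d k\<close> above \<open>x\<close> is ranked no later than \<open>x\<close>, so it would refute that \<open>x\<close> is a best approximation.\<close>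
    have "\<exists>k. x < d k"
      using r less_cSupD[of "range d" x] unfolding c_def by auto
    then obtain k where k: "x < d k" "\<And>j. j < k \<Longrightarrow> d j \<le> x"
      unfolding exists_least_iff[of "\<lambda>k. x < d k"] by (auto simp: not_less)
    then obtain j where j: "k = Suc j" using r by (cases k) auto
    show "x \<in> range d"
    proof (rule ccontr)
      assume "x \<notin> range d"
      then have "d j < x" using k(2)[of j] j by (metis lessI less_le rangeI)
      moreover have "x < v (Suc j)" using r cv[of "Suc j"] by simp
      ultimately have "G (d (Suc j)) \<subseteq> G x" using ext(4)[of x j] r by blast
      then have "d (Suc j) \<in> G x" using G_self good(1) by blast
      then show False using r good(1)[of "Suc j"] dc[of "Suc j"] k(1) j by blast
    qed
  qed
  have grow: "G (d k) \<subseteq> G (d (Suc k))" "d (Suc k) \<notin> G (d k)" for k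
  proof -
    show *: "d (Suc k) \<notin> G (d k)"
      using good(3)[of k] ext(1)[of k] dv[of "Suc k" k] by force
    then show "G (d k) \<subseteq> G (d (Suc k))"
      using G_chain[of "d k" "d (Suc k)"] G_self good(1) by blast
  qed
  \<comment> \<open>Since the levels grow, every \<open>G x\<close> is eventually contained in one: they exhaust \<open>D\<close>.\<close>
  have card: "k \<le> card (G (d k))" for k
  proof (induction k)
    case (Suc k)
    have "G (d k) \<subset> G (d (Suc k))"
      using grow[of k] G_self[OF good(1)[of "Suc k"]] by blast
    then have "card (G (d k)) < card (G (d (Suc k)))"
      using G_finite[OF good(1)] by (intro psubset_card_mono) auto
    then show ?case using Suc by simp
  qed simp
  have x0: "x \<in> G (d 0)" "y \<in> G (d 0)" using M(2) s(2) by (auto simp: d_def)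
  obtain w where w: "is_next (G (d 0)) x w"
    using is_next_exists[OF G_finite[OF good(1)] x0(2) y(2)] by blast
  have "branching_levels (\<lambda>k. G (d k)) x w"
  proof
    show "finite (G (d k))" "separates (G (d k)) (G (d (Suc k)))" for k
      using G_finite good(1) ext(3) by auto
    show "x \<in> G (d 0)" "is_next (G (d 0)) x w" by fact+
    fix p q assume pq: "x \<le> p" "p < q" "q \<le> w"
    have "w \<in> D" using w G_sub by (auto simp: is_next_def)
    then obtain z where z: "z \<in> D" "p < z" "z < q"
      using D_dense[of p q] pq x D_sub by force
    have "\<not> G (d (Suc (card (G z)))) \<subseteq> G z"
      using card[of "Suc (card (G z))"] card_mono[OF G_finite[OF z(1)]] by (meson Suc_n_not_le_n le_trans)
    then have "z \<in> G (d (Suc (card (G z))))"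
      using G_chain[OF z(1) good(1)] G_self[OF z(1)] by blast
    then show "\<exists>k. \<exists>z\<in>G (d k). p < z \<and> z < q" using z by blast
  qed
  then show thesis
    using that good(1) d_mono range by blast
qed

end

context real_group_expansion
begin

text \<open>
  The natural number \<open>k\<close> is represented by \<open>d k\<close> from the sparse sequence, and a set of natural numbers
  by the real that codes it in the levels \<open>G (d k)\<close>. Everything is definable from the tower, since the
  level of a point \<open>n\<close> of the sequence is \<open>G n\<close> and the successor is the next point of the sequence.
\<close>
theorem dense_tower_defines_B:
  assumes F: "tower F" and ab: "a < b"
    and dense: "\<And>p q. \<lbrakk>a \<le> p; p < q; q \<le> b\<rbrakk> \<Longrightarrow> \<exists>i>0. \<exists>x\<in>F i. p < x \<and> x < q"
  shows "defines_B R"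
proof -
  define D where "D = {x. a < x \<and> x < b \<and> (\<exists>i. 0 < i \<and> x \<in> F i)}"
  define G where "G d = {x. x \<in> D \<and> (\<forall>i. 0 < i \<longrightarrow> d \<in> F i \<longrightarrow> x \<in> F i)}" for d
  interpret ranked_dense_set D G a b
  proof
    show "finite (G d)" if "d \<in> D" for d
    proof -
      obtain i where "0 < i" "d \<in> F i" using \<open>d \<in> D\<close> unfolding D_def by blast
      then have "G d \<subseteq> F i" unfolding G_def by blast
      then show ?thesis using towerD(2)[OF F \<open>0 < i\<close>] finite_subset by blast
    qed
    show "G x \<subseteq> G y \<or> G y \<subseteq> G x" if "x \<in> D" "y \<in> D" for x y
    proof (rule ccontr)
      assume "\<not> ?thesis"
      then obtain i j where "0 < i" "y \<in> F i" "x \<notin> F i" "0 < j" "x \<in> F j" "y \<notin> F j"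
        unfolding G_def by blast
      then show False
        using towerD(3)[OF F, of i j] towerD(3)[OF F, of j i] by (cases "i \<le> j") auto
    qed
    show "\<exists>x\<in>D. p < x \<and> x < q" if "a \<le> p" "p < q" "q \<le> b" for p q
      using dense[OF that] that unfolding D_def by force
  qed (use ab in \<open>auto simp: D_def G_def\<close>)
  obtain d c u w where d: "\<And>k. d k \<in> D" "strict_mono d"
    and range: "\<And>x. x \<in> range d \<longleftrightarrow>
        x \<in> D \<and> d 0 \<le> x \<and> x < c \<and> (\<forall>y. y \<in> D \<longrightarrow> x < y \<longrightarrow> y < c \<longrightarrow> y \<notin> G x)"
    and bl: "branching_levels (\<lambda>k. G (d k)) u w"
    using sparse_sequence by blast
  interpret branching_levels "\<lambda>k. G (d k)" u w by (fact bl)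
  define N where "N = range d"
  have next_N: "is_next N (d k) y \<longleftrightarrow> y = d (Suc k)" for k y
  proof -
    have "is_next N (d k) (d (Suc k))"
      using d(2) by (auto simp: is_next_def N_def strict_mono_less strict_mono_less_eq)
    then show ?thesis using is_next_unique by blast
  qed
  \<comment> \<open>Quantification over \<open>k\<close> is replaced by quantification over the definable set \<open>N\<close>.\<close>
  have codes: "c' \<in> codes \<longleftrightarrow> is_pred (G (d 0)) c' u \<and> c' \<le> w \<and>
     (\<forall>n n'. n \<in> N \<longrightarrow> is_next N n n' \<longrightarrow> (\<exists>l l'. is_pred (G n) c' l \<and> is_pred (G n') c' l' \<and>
        (is_next (G n') l l' \<or> is_next2 (G n') l l')))" for c'
    unfolding codes_def using next_N by (auto simp: N_def)
  have "dpred (\<lambda>e. e 0 \<in> D)"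
    unfolding D_def mem_Collect_eq by (intro definable_intros dpred_tower[OF F])
  note D_pred = definable_pred_mem[OF this]
  have "dpred (\<lambda>e. e 1 \<in> G (e 0))"
    unfolding G_def mem_Collect_eq by (intro definable_intros dpred_tower[OF F] D_pred)
  note G_pred = definable_pred_mem_family[OF this]
  have "dpred (\<lambda>e. e 0 \<in> N)"
    unfolding N_def range by (intro definable_intros D_pred G_pred)
  note N_pred = definable_pred_mem[OF this]
  have "dpred (\<lambda>e. is_next N (e 0) (e 1))"
    unfolding is_next_def by (intro definable_intros N_pred)
  note next_pred = definable_pred_subst2[where A = "is_next N", OF this]
  show ?thesis
  proof (rule defines_B_on_reals[where P = codes and N = N and S = "is_next N" and d = d and h = bits
        and E = "\<lambda>n x. \<exists>n' l l'. is_next N n n' \<and> is_pred (G n) x l \<and>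
                  is_pred (G n') x l' \<and> is_next2 (G n') l l'"])
    show "dpred (\<lambda>e. e 0 \<in> codes)"
      unfolding codes
      unfolding is_next2_def is_next_def[of "G _"] is_pred_def
      by (intro definable_intros N_pred next_pred G_pred)
    show "dpred (\<lambda>e. e 0 \<in> N)" "dpred (\<lambda>e. is_next N (e 0) (e 1))"
      by (intro definable_intros N_pred next_pred)+
    show "bij_betw d UNIV N"
      using d(2) by (simp add: N_def bij_betw_def strict_mono_imp_inj_on)
    show "bij_betw bits codes UNIV" by (fact bits_bij)
    show "dpred (\<lambda>e. \<exists>n' l l'. is_next N (e 0) n' \<and> is_pred (G (e 0)) (e 1) l \<and>
            is_pred (G n') (e 1) l' \<and> is_next2 (G n') l l')"
      unfolding is_next2_def is_next_def[of "G _"] is_pred_def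
      by (intro definable_intros N_pred next_pred G_pred)
    show "(\<exists>n' l l'. is_next N (d k) n' \<and> is_pred (G (d k)) x l \<and>
            is_pred (G n') x l' \<and> is_next2 (G n') l l') \<longleftrightarrow> k \<in> bits x" for k x
      unfolding next_N bits_def by auto
    show "is_next N (d k) y \<longleftrightarrow> y = d (Suc k)" for k y by (fact next_N)
  qed
qed

end

section \<open>Peaks and monotonicity\<close>

text \<open>
  Distinct elements of \<open>S\<close> have different \<open>\<lfloor>(x - a) / d\<rfloor>\<close>.
\<close>
lemma finite_separated:
  fixes S :: "real set"
  assumes "S \<subseteq> {a..b}" "0 < d"
    and sep: "\<And>x y. \<lbrakk>x \<in> S; y \<in> S; x < y\<rbrakk> \<Longrightarrow> d \<le> y - x"
  shows "finite S"
proof -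
  let ?g = "\<lambda>x. \<lfloor>(x - a) / d\<rfloor>"
  have "inj_on ?g S"
  proof (rule linorder_inj_onI)
    fix x y assume "x < y" and xy: "x \<in> S" "y \<in> S"
    then have "d \<le> y - x" using sep by blast
    then have "(x - a + d) / d \<le> (y - a) / d"
      using \<open>0 < d\<close> by (intro divide_right_mono) auto
    then have "(x - a) / d + 1 \<le> (y - a) / d"
      using \<open>0 < d\<close> by (simp add: add_divide_distrib)
    then show "?g x \<noteq> ?g y" by linarith
  qed auto
  moreover have "?g ` S \<subseteq> {0..\<lfloor>(b - a) / d\<rfloor>}"
    using assms(1,2) by (force intro!: floor_mono divide_right_mono divide_nonneg_pos)
  ultimately show ?thesis
    using finite_imageD finite_subset by blast
qed

text \<open>
  Points at which \<open>h\<close> has a local maximum on the interval of radius \<open>\<delta>\<close>. Strictness on the left only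
  makes peaks \<open>\<delta>\<close>-separated, without losing them when the maximum is attained on a larger set: the
  leftmost point of that set is a peak.
\<close>
definition peaks :: "(real \<Rightarrow> real) \<Rightarrow> real \<Rightarrow> real \<Rightarrow> real \<Rightarrow> real set" where
  "peaks h a b \<delta> = {x. a \<le> x - \<delta> \<and> x + \<delta> \<le> b \<and>
     (\<forall>y. x - \<delta> \<le> y \<longrightarrow> y \<le> x + \<delta> \<longrightarrow> h y \<le> h x) \<and>
     (\<forall>y. x - \<delta> \<le> y \<longrightarrow> y < x \<longrightarrow> h y < h x)}"

lemma finite_peaks:
  assumes "0 < \<delta>"
  shows "finite (peaks h a b \<delta>)"
proof (rule finite_separated[OF _ assms])
  show "peaks h a b \<delta> \<subseteq> {a..b}" using assms by (auto simp: peaks_def)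
  fix x y assume xy: "x \<in> peaks h a b \<delta>" "y \<in> peaks h a b \<delta>" "x < y"
  show "\<delta> \<le> y - x"
  proof (rule ccontr)
    assume "\<not> \<delta> \<le> y - x"
    then have "h y \<le> h x" "h x < h y"
      using xy by (auto simp: peaks_def)
    then show False by simp
  qed
qed

lemma peaks_antimono: "\<delta> \<le> \<delta>' \<Longrightarrow> peaks h a b \<delta>' \<subseteq> peaks h a b \<delta>"
  by (auto simp: peaks_def)

lemma peak_exists:
  assumes cont: "continuous_on {p..r} h" and pr: "a \<le> p" "r \<le> b"
    and q: "p \<le> q" "q \<le> r" "h p < h q" "h r < h q"
  shows "\<exists>\<delta>>0. \<exists>x\<in>peaks h a b \<delta>. p < x \<and> x < r"
proof -
  obtain x0 where x0: "x0 \<in> {p..r}" "\<And>y. y \<in> {p..r} \<Longrightarrow> h y \<le> h x0"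
    using continuous_attains_sup[OF _ _ cont] q by (auto simp: Ball_def)
  let ?S = "{x \<in> {p..r}. h x0 \<le> h x}"
  have "closed ?S"
    using cont by (intro continuous_on_closed_Collect_le) auto
  then have "compact ?S"
    using compact_Int_closed[of "{p..r}" ?S] by (simp add: Int_absorb1 subset_eq)
  moreover have "?S \<noteq> {}" using x0 by auto
  ultimately obtain m where m: "m \<in> ?S" "\<And>y. y \<in> ?S \<Longrightarrow> m \<le> y"
    using compact_attains_inf[of ?S] by blast
  have hq: "h q \<le> h x0" using x0 q by auto
  then have "m \<noteq> p" "m \<noteq> r" using m q by force+
  then have mpr: "p < m" "m < r" using m by auto
  define \<delta> where "\<delta> = min (m - p) (r - m)"
  have "m \<in> peaks h a b \<delta>"
    unfolding peaks_def
  proof (intro CollectI conjI allI impI)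
    show "a \<le> m - \<delta>" "m + \<delta> \<le> b" using pr by (auto simp: \<delta>_def)
    fix y assume y: "m - \<delta> \<le> y"
    have *: "p \<le> y" using y by (auto simp: \<delta>_def)
    show "h y \<le> h m" if "y \<le> m + \<delta>"
    proof -
      have "y \<le> r" using that by (simp add: \<delta>_def min_def split: if_splits)
      then show ?thesis using x0(2)[of y] m(1) * by auto
    qed
    show "h y < h m" if "y < m"
    proof (rule ccontr)
      assume "\<not> h y < h m"
      then have "y \<in> ?S" using m(1) * that by auto
      then show False using m(2)[of y] that by auto
    qed
  qed
  then show ?thesis using mpr by (intro exI[of _ \<delta>]) (auto simp: \<delta>_def)
qed

lemma monotone_if_no_turn:
  fixes h :: "real \<Rightarrow> real"
  assumes "\<And>x y z. \<lbrakk>p \<le> x; x < y; y < z; z \<le> q\<rbrakk> \<Longrightarrow> \<not> (h x < h y \<and> h z < h y)"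
    and "\<And>x y z. \<lbrakk>p \<le> x; x < y; y < z; z \<le> q\<rbrakk> \<Longrightarrow> \<not> (h y < h x \<and> h y < h z)"
    and "h p \<le> h q"
  shows "mono_on {p..q} h"
proof (rule mono_onI)
  have from_p: "h p \<le> h x" and to_q: "h x \<le> h q" if "p \<le> x" "x \<le> q" for x
    using assms(1)[of p x q] assms(2)[of p x q] assms(3) that by (cases "x = p"; cases "x = q"; force)+
  fix x y assume "x \<in> {p..q}" "y \<in> {p..q}" "x \<le> y"
  then show "h x \<le> h y"
    using assms(2)[of x y q] assms(1)[of p x y] from_p[of x] to_q[of x] from_p[of y] to_q[of y]
    by (cases "x = p"; cases "y = q"; cases "x = y"; force)
qed

lemma monotone_if_no_peaks:
  assumes cont: "continuous_on {p..q} h" and pq: "a \<le> p" "p \<le> q" "q \<le> b"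
    and no_peak: "\<And>\<delta> x. \<lbrakk>0 < \<delta>; p < x; x < q\<rbrakk> \<Longrightarrow>
      x \<notin> peaks h a b \<delta> \<and> x \<notin> peaks (\<lambda>x. - h x) a b \<delta>"
  shows "mono_on {p..q} h \<or> mono_on {p..q} (\<lambda>x. - h x)"
proof -
  have max: "\<not> (h x < h y \<and> h z < h y)" if xyz: "p \<le> x" "x < y" "y < z" "z \<le> q" for x y z
  proof
    assume *: "h x < h y \<and> h z < h y"
    have "continuous_on {x..z} h" using cont xyz by (auto intro: continuous_on_subset)
    then obtain \<delta> w where "\<delta> > 0" "w \<in> peaks h a b \<delta>" "x < w" "w < z"
      using peak_exists[of x z h a b y] xyz * pq by auto
    then show False using no_peak[of \<delta> w] xyz by auto
  qed
  have min: "\<not> (h y < h x \<and> h y < h z)" if xyz: "p \<le> x" "x < y" "y < z" "z \<le> q" for x y z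
  proof
    assume *: "h y < h x \<and> h y < h z"
    have "continuous_on {x..z} (\<lambda>x. - h x)"
      using cont xyz by (intro continuous_on_minus) (auto intro: continuous_on_subset)
    then obtain \<delta> w where "\<delta> > 0" "w \<in> peaks (\<lambda>x. - h x) a b \<delta>" "x < w" "w < z"
      using peak_exists[of x z "\<lambda>x. - h x" a b y] xyz * pq by auto
    then show False using no_peak[of \<delta> w] xyz by auto
  qed
  show ?thesis
  proof (cases "h p \<le> h q")
    case True
    then show ?thesis using monotone_if_no_turn[of p q h] max min by blast
  next
    case False
    then show ?thesis using monotone_if_no_turn[of p q "\<lambda>x. - h x"] max min by auto
  qed
qed

context real_group_expansion
begin

text \<open>
  The peaks of \<open>f\<close> and \<open>- f\<close> form a tower, which is not dense. A continuous function without peaks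
  in either direction is monotone.
\<close>
lemma monotone_somewhere:
  assumes nB: "\<not> defines_B R"
    and f: "dpred (\<lambda>e. e 0 = f (e 1))" and cont: "continuous_on {a..b} f" and ab: "a < b"
  obtains p q where "a \<le> p" "p < q" "q \<le> b" "mono_on {p..q} f \<or> mono_on {p..q} (\<lambda>x. - f x)"
proof -
  define F where "F \<delta> = peaks f a b \<delta> \<union> peaks (\<lambda>x. - f x) a b \<delta>" for \<delta>
  have "tower F"
    unfolding tower_def
  proof (intro conjI allI impI)
    show "dpred (\<lambda>e. e 1 \<in> F (e 0))"
      unfolding F_def Un_iff peaks_def mem_Collect_eq
      by (intro definable_intros definable_term_app[OF f])
    show "finite (F i)" if "0 < i" for i using that by (simp add: F_def finite_peaks)
    show "F j \<subseteq> F i" if "i \<le> j" for i j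
      unfolding F_def using peaks_antimono[OF that] by blast
  qed
  with nB obtain p q where pq: "a \<le> p" "p < q" "q \<le> b" "\<And>i x. \<lbrakk>0 < i; x \<in> F i\<rbrakk> \<Longrightarrow> \<not> (p < x \<and> x < q)"
    using dense_tower_defines_B[OF _ ab] by blast
  have "mono_on {p..q} f \<or> mono_on {p..q} (\<lambda>x. - f x)"
    using pq cont by (intro monotone_if_no_peaks[where a = a and b = b])
      (auto simp: F_def intro: continuous_on_subset)
  then show thesis using that pq by blast
qed

end

definition strict_incr_at :: "(real \<Rightarrow> real) \<Rightarrow> real \<Rightarrow> bool" where
  "strict_incr_at f x \<longleftrightarrow> (\<exists>\<delta>. 0 < \<delta> \<and>
     (\<forall>y z. x - \<delta> < y \<longrightarrow> y < z \<longrightarrow> z < x + \<delta> \<longrightarrow> f y < f z))"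

definition const_at :: "(real \<Rightarrow> real) \<Rightarrow> real \<Rightarrow> bool" where
  "const_at f x \<longleftrightarrow> (\<exists>\<delta>. 0 < \<delta> \<and> (\<forall>y. x - \<delta> < y \<longrightarrow> y < x + \<delta> \<longrightarrow> f y = f x))"

lemma open_strict_incr_at: "open {x. strict_incr_at f x}"
  unfolding open_dist
proof (intro ballI)
  fix x assume "x \<in> {x. strict_incr_at f x}"
  then obtain \<delta> where \<delta>: "0 < \<delta>" "\<And>y z. \<lbrakk>x - \<delta> < y; y < z; z < x + \<delta>\<rbrakk> \<Longrightarrow> f y < f z"
    unfolding strict_incr_at_def by blast
  have "strict_incr_at f x'" if "dist x' x < \<delta> / 2" for x'
  proof -
    have *: "x - \<delta> / 2 < x'" "x' < x + \<delta> / 2" using that unfolding dist_real_def by linarith+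
    have "f y < f z" if "x' - \<delta> / 2 < y" "y < z" "z < x' + \<delta> / 2" for y z
      using that * by (intro \<delta>(2)) linarith+
    then show ?thesis
      unfolding strict_incr_at_def using \<delta>(1) by (intro exI[of _ "\<delta> / 2"]) auto
  qed
  then show "\<exists>e>0. \<forall>y. dist y x < e \<longrightarrow> y \<in> {x. strict_incr_at f x}"
    using \<delta>(1) by (intro exI[of _ "\<delta> / 2"]) auto
qed

lemma open_const_at: "open {x. const_at f x}"
  unfolding open_dist
proof (intro ballI)
  fix x assume "x \<in> {x. const_at f x}"
  then obtain \<delta> where \<delta>: "0 < \<delta>" "\<And>y. \<lbrakk>x - \<delta> < y; y < x + \<delta>\<rbrakk> \<Longrightarrow> f y = f x"
    unfolding const_at_def by blast
  have "const_at f x'" if "dist x' x < \<delta> / 2" for x'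
  proof -
    have *: "x - \<delta> / 2 < x'" "x' < x + \<delta> / 2" using that unfolding dist_real_def by linarith+
    have "f x' = f x"
      using * \<delta>(1) by (intro \<delta>(2)) linarith+
    moreover have "f y = f x" if "x' - \<delta> / 2 < y" "y < x' + \<delta> / 2" for y
      using that * by (intro \<delta>(2)) linarith+
    ultimately show ?thesis
      unfolding const_at_def using \<delta>(1) by (intro exI[of _ "\<delta> / 2"]) auto
  qed
  then show "\<exists>e>0. \<forall>y. dist y x < e \<longrightarrow> y \<in> {x. const_at f x}"
    using \<delta>(1) by (intro exI[of _ "\<delta> / 2"]) auto
qed

text \<open>
  A maximum of \<open>f\<close> on a compact interval can only be attained at the right end point.
\<close>
lemma strict_mono_on_if_locally:
  fixes f :: "real \<Rightarrow> real"
  assumes "connected C" "continuous_on C f" "\<And>x. x \<in> C \<Longrightarrow> strict_incr_at f x"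
  shows "strict_mono_on C f"
proof (rule strict_mono_onI)
  fix x y assume xy: "x \<in> C" "y \<in> C" "x < y"
  have sub: "{x..y} \<subseteq> C" using assms(1) xy by (simp add: connected_contains_Icc)
  then have "continuous_on {x..y} f" using assms(2) continuous_on_subset by blast
  then obtain m where m: "m \<in> {x..y}" "\<And>z. z \<in> {x..y} \<Longrightarrow> f z \<le> f m"
    using continuous_attains_sup[of "{x..y}" f] xy by auto
  have not_max: "m = y" if m: "m \<in> {x..y}" "\<And>z. z \<in> {x..y} \<Longrightarrow> f z \<le> f m" for m
  proof (rule ccontr)
    assume "m \<noteq> y"
    then have "m < y" using m by auto
    obtain \<delta> where \<delta>: "0 < \<delta>" "\<And>u v. \<lbrakk>m - \<delta> < u; u < v; v < m + \<delta>\<rbrakk> \<Longrightarrow> f u < f v"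
      using assms(3)[of m] sub m unfolding strict_incr_at_def by blast
    obtain v where "m < v" "v < min y (m + \<delta>)"
      using dense[of m "min y (m + \<delta>)"] \<open>m < y\<close> \<delta>(1) by auto
    then show False using \<delta>(2)[of m v] m(2)[of v] m(1) \<delta>(1) by auto
  qed
  have "\<not> f y \<le> f x"
  proof
    assume "f y \<le> f x"
    then have "\<And>z. z \<in> {x..y} \<Longrightarrow> f z \<le> f x"
      using m not_max[OF m] by force
    then show False using not_max[of x] xy by auto
  qed
  then show "f x < f y" by simp
qed

lemma constant_on_if_locally:
  fixes f :: "real \<Rightarrow> real"
  assumes "connected C" "\<And>x. x \<in> C \<Longrightarrow> const_at f x"
  shows "f constant_on C"
proof -
  have "(f has_field_derivative 0) (at x within C)" if x: "x \<in> C" for x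
  proof -
    obtain \<delta> where \<delta>: "0 < \<delta>" "\<And>y. \<lbrakk>x - \<delta> < y; y < x + \<delta>\<rbrakk> \<Longrightarrow> f y = f x"
      using assms(2)[OF x] unfolding const_at_def by blast
    have "((\<lambda>_. f x) has_field_derivative 0) (at x)" by simp
    then have "(f has_field_derivative 0) (at x)"
    proof (rule has_field_derivative_transform_within_open[where S = "{x - \<delta><..<x + \<delta>}"])
      show "f x = f y" if "y \<in> {x - \<delta><..<x + \<delta>}" for y using \<delta>(2)[of y] that by simp
    qed (use \<delta>(1) in auto)
    then show ?thesis by (rule has_field_derivative_at_within)
  qed
  moreover have "convex C" using assms(1) is_interval_convex_1 is_interval_connected_1 by blast
  ultimately show ?thesis
    using has_field_derivative_zero_constant[of C f] by (auto simp: constant_on_def)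
qed

text \<open>
  A monotone function that is not injective is constant on an interval.
\<close>
lemma strict_incr_or_const_if_mono:
  fixes f :: "real \<Rightarrow> real"
  assumes "mono_on {p..q} f" "p < q"
  shows "\<exists>x. p < x \<and> x < q \<and> (strict_incr_at f x \<or> const_at f x)"
proof (cases "\<forall>x y. p < x \<longrightarrow> x < y \<longrightarrow> y < q \<longrightarrow> f x < f y")
  case True
  let ?x = "(p + q) / 2"
  have "strict_incr_at f ?x"
    unfolding strict_incr_at_def
    using assms(2) True by (intro exI[of _ "(q - p) / 2"]) (auto simp: field_simps)
  then show ?thesis using assms(2) by (intro exI[of _ ?x]) auto
next
  case False
  then obtain x y where xy: "p < x" "x < y" "y < q" "f y \<le> f x" by (auto simp: not_less)
  have eq: "f z = f x" if "x \<le> z" "z \<le> y" for z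
    using mono_onD[OF assms(1), of x z] mono_onD[OF assms(1), of z y] that xy by auto
  let ?z = "(x + y) / 2"
  have "const_at f ?z"
    unfolding const_at_def
    using xy eq[of ?z] by (intro exI[of _ "(y - x) / 2"]) (auto simp: field_simps intro!: eq)
  then show ?thesis using xy by (intro exI[of _ ?z]) auto
qed

lemma closure_eq_UNIV_if:
  fixes U :: "real set"
  assumes "\<And>a b. a < b \<Longrightarrow> \<exists>x\<in>U. a < x \<and> x < b"
  shows "closure U = UNIV"
proof -
  have "x \<in> closure U" for x
    unfolding closure_approachable
  proof (intro allI impI)
    fix e :: real assume "0 < e"
    then obtain y where "y \<in> U" "x < y" "y < x + e" using assms[of x "x + e"] by auto
    then show "\<exists>y\<in>U. dist y x < e" by (intro bexI[of _ y]) (auto simp: dist_real_def)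
  qed
  then show ?thesis by auto
qed

lemma connected_in_one_of_two_open:
  fixes C :: "real set"
  assumes "connected C" "C \<subseteq> A \<union> B" "open A" "open B" "A \<inter> B = {}"
  shows "C \<subseteq> A \<or> C \<subseteq> B"
  using connectedD[OF assms(1,3,4)] assms by blast

lemma strict_incr_at_right:
  assumes "strict_incr_at f x"
  obtains \<delta> where "0 < \<delta>" "\<And>y. \<lbrakk>x < y; y < x + \<delta>\<rbrakk> \<Longrightarrow> f x < f y"
proof -
  obtain \<delta> where \<delta>: "0 < \<delta>" "\<And>y z. x - \<delta> < y \<Longrightarrow> y < z \<Longrightarrow> z < x + \<delta> \<Longrightarrow> f y < f z"
    using assms unfolding strict_incr_at_def by blast
  show thesis using \<delta>(1) by (intro that[of \<delta>] \<delta>(2)) auto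
qed

lemma const_at_right:
  assumes "const_at f x"
  obtains \<delta> where "0 < \<delta>" "\<And>y. \<lbrakk>x < y; y < x + \<delta>\<rbrakk> \<Longrightarrow> f x = f y"
proof -
  obtain \<delta> where \<delta>: "0 < \<delta>" "\<And>y. x - \<delta> < y \<Longrightarrow> y < x + \<delta> \<Longrightarrow> f y = f x"
    using assms unfolding const_at_def by blast
  show thesis using \<delta>(1) by (intro that[of \<delta>] \<delta>(2)[symmetric]) auto
qed

lemma monotonicity_types_disjoint:
  "\<not> (strict_incr_at f x \<and> const_at f x)"
  "\<not> (strict_incr_at f x \<and> strict_incr_at (\<lambda>x. - f x) x)"
proof -
  have common: "\<exists>y. x < y \<and> y < x + \<delta> \<and> y < x + \<delta>'" if "0 < \<delta>" "0 < \<delta>'" for \<delta> \<delta>'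
    using dense[of x "min (x + \<delta>) (x + \<delta>')"] that by auto
  show "\<not> (strict_incr_at f x \<and> const_at f x)"
    by (metis common strict_incr_at_right const_at_right less_irrefl)
  show "\<not> (strict_incr_at f x \<and> strict_incr_at (\<lambda>x. - f x) x)"
    using common by (metis strict_incr_at_right neg_less_iff_less less_asym)
qed

context real_group_expansion
begin

text \<open>
  The three alternatives are open and mutually exclusive, so a connected subset satisfies the same
  alternative throughout.
\<close>
definition monotone_set :: "(real \<Rightarrow> real) \<Rightarrow> real set" where
  "monotone_set f = {x. strict_incr_at f x \<or> strict_incr_at (\<lambda>x. - f x) x \<or> const_at f x}"

lemma open_monotone_set: "open (monotone_set f)"
  unfolding monotone_set_def
  by (intro open_Collect_disj open_strict_incr_at open_const_at)

lemma definable_monotone_set: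
  assumes f: "dpred (\<lambda>e. e 0 = f (e 1))"
  shows "definable_set1 R (monotone_set f)"
  unfolding definable_set1_def
proof (rule definable_singletons)
  show "dpred (\<lambda>e. e 0 \<in> monotone_set f)"
    unfolding monotone_set_def mem_Collect_eq strict_incr_at_def const_at_def
    by (intro definable_intros definable_term_app[OF f])
qed

lemma const_at_uminus: "const_at (\<lambda>x. - f x) x \<longleftrightarrow> const_at f x" for f :: "real \<Rightarrow> real"
  by (simp add: const_at_def)

lemma monotone_set_dense:
  assumes "\<not> defines_B R" "dpred (\<lambda>e. e 0 = f (e 1))" "continuous_on UNIV f" "a < b"
  shows "\<exists>x\<in>monotone_set f. a < x \<and> x < b"
proof -
  have "continuous_on {a..b} f" using assms(3) continuous_on_subset by blast
  from monotone_somewhere[OF assms(1,2) this assms(4)]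
  obtain p q where pq: "a \<le> p" "p < q" "q \<le> b" "mono_on {p..q} f \<or> mono_on {p..q} (\<lambda>x. - f x)" .
  then obtain x where x: "p < x" "x < q" "x \<in> monotone_set f"
    using strict_incr_or_const_if_mono[of p q f] strict_incr_or_const_if_mono[of p q "\<lambda>x. - f x"]
    by (auto simp: monotone_set_def const_at_uminus)
  then show ?thesis using pq by force
qed

lemma monotone_on_components:
  assumes "continuous_on UNIV f" "connected C" "C \<subseteq> monotone_set f"
  shows "strict_mono_on C f \<or> strict_antimono_on C f \<or> f constant_on C"
proof -
  let ?I = "{x. strict_incr_at f x}" and ?D = "{x. strict_incr_at (\<lambda>x. - f x) x}"
    and ?K = "{x. const_at f x}"
  have "C \<subseteq> ?I \<or> C \<subseteq> ?D \<union> ?K"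
    using monotonicity_types_disjoint[of f] assms(3)
    by (intro connected_in_one_of_two_open[OF assms(2)] open_Un open_strict_incr_at open_const_at)
       (auto simp: monotone_set_def)
  moreover have "C \<subseteq> ?D \<or> C \<subseteq> ?K" if "C \<subseteq> ?D \<union> ?K"
    using monotonicity_types_disjoint[of "\<lambda>x. - f x"] that
    by (intro connected_in_one_of_two_open[OF assms(2)] open_strict_incr_at open_const_at)
       (auto simp: const_at_uminus)
  ultimately consider "C \<subseteq> ?I" | "C \<subseteq> ?D" | "C \<subseteq> ?K" by blast
  then show ?thesis
  proof cases
    case 1
    then show ?thesis
      using assms continuous_on_subset by (blast intro: strict_mono_on_if_locally)
  next
    case 2
    have "continuous_on C (\<lambda>x. - f x)"
      using assms(1) continuous_on_subset by (blast intro: continuous_on_minus)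
    with 2 have "strict_mono_on C (\<lambda>x. - f x)"
      using assms(2) by (blast intro: strict_mono_on_if_locally)
    then have "strict_antimono_on C f"
      by (auto simp: monotone_on_def)
    then show ?thesis by blast
  next
    case 3
    then show ?thesis using constant_on_if_locally assms(2) by blast
  qed
qed

end

section \<open>Lipschitz points of monotone functions\<close>

text \<open>
  One-sided bound, which is the Lipschitz condition for increasing functions.
\<close>
definition lipschitz_above :: "(real \<Rightarrow> real) \<Rightarrow> real \<Rightarrow> real \<Rightarrow> bool" where
  "lipschitz_above h p q \<longleftrightarrow> (\<exists>C. \<forall>x y. p \<le> x \<longrightarrow> x \<le> y \<longrightarrow> y \<le> q \<longrightarrow> h y - h x \<le> C * (y - x))"

text \<open>
  If the increment of \<open>h\<close> over a step of length \<open>\<epsilon>\<close> at \<open>x\<close> is at most the increment at every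
  point of \<open>[s, t]\<close>, then it is at most the average over about \<open>(t - s) / \<epsilon>\<close> consecutive steps in that
  interval, where the increments telescope. The factor 2 absorbs the rounding. The resulting
  constant does not depend on \<open>\<epsilon>\<close>.
\<close>
lemma increment_bound_if_minimal:
  fixes h :: "real \<Rightarrow> real"
  assumes "s < t" "0 < \<epsilon>" "2 * \<epsilon> \<le> t - s"
    and H: "\<And>z. \<lbrakk>s \<le> z; z \<le> t\<rbrakk> \<Longrightarrow> h z - h s \<le> H" and "0 \<le> H"
    and min: "\<And>z. \<lbrakk>s \<le> z; z \<le> t\<rbrakk> \<Longrightarrow> h (x + \<epsilon>) - h x \<le> h (z + \<epsilon>) - h z"
  shows "h (x + \<epsilon>) - h x \<le> 2 * H / (t - s) * \<epsilon>"
proof -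
  define n where "n = nat \<lfloor>(t - s) / \<epsilon>\<rfloor>"
  have "2 \<le> (t - s) / \<epsilon>" using assms by (simp add: field_simps)
  moreover from this have "real n = of_int \<lfloor>(t - s) / \<epsilon>\<rfloor>" by (simp add: n_def)
  ultimately have n: "real n \<le> (t - s) / \<epsilon>" "(t - s) / \<epsilon> \<le> 2 * real n" "0 < n"
    by linarith+
  have n\<epsilon>: "real n * \<epsilon> \<le> t - s" "t - s \<le> 2 * real n * \<epsilon>"
    using n(1,2) \<open>0 < \<epsilon>\<close> by (simp_all add: field_simps)
  have "real k * (h (x + \<epsilon>) - h x) \<le> h (s + real k * \<epsilon>) - h s" if "k \<le> n" for k
    using that
  proof (induction k)
    case (Suc k)
    have "real k * \<epsilon> \<le> real n * \<epsilon>" "0 \<le> real k * \<epsilon>"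
      using Suc.prems \<open>0 < \<epsilon>\<close> by simp_all
    then have "s \<le> s + real k * \<epsilon>" "s + real k * \<epsilon> \<le> t"
      using n\<epsilon>(1) by linarith+
    then have "h (x + \<epsilon>) - h x \<le> h (s + real k * \<epsilon> + \<epsilon>) - h (s + real k * \<epsilon>)"
      by (rule min)
    with Suc show ?case by (simp add: algebra_simps)
  qed simp
  from this[of n] have "real n * (h (x + \<epsilon>) - h x) \<le> H"
    using H[of "s + real n * \<epsilon>"] n\<epsilon>(1) \<open>0 < \<epsilon>\<close> by force
  then have "h (x + \<epsilon>) - h x \<le> H / real n"
    using \<open>0 < n\<close> by (simp add: field_simps)
  also have "\<dots> \<le> 2 * H / (t - s) * \<epsilon>"
  proof -
    have "H * (t - s) \<le> H * (2 * real n * \<epsilon>)"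
      using n\<epsilon>(2) \<open>0 \<le> H\<close> by (rule mult_left_mono)
    then show ?thesis using \<open>s < t\<close> \<open>0 < n\<close> by (simp add: field_simps)
  qed
  finally show ?thesis .
qed

text \<open>
  Arbitrarily small steps suffice: steps of length \<open>\<epsilon>\<close> from \<open>x\<close> come within \<open>\<epsilon>\<close> of any \<open>y\<close>, and
  continuity takes care of the rest.
\<close>
lemma lipschitz_above_if_small_increments:
  fixes h :: "real \<Rightarrow> real"
  assumes cont: "continuous_on {p..q} h" and "0 \<le> C"
    and small: "\<And>\<delta>. 0 < \<delta> \<Longrightarrow> \<exists>\<epsilon>. 0 < \<epsilon> \<and> \<epsilon> < \<delta> \<and> (\<forall>x. p \<le> x \<longrightarrow> x \<le> q \<longrightarrow> h (x + \<epsilon>) - h x \<le> C * \<epsilon>)"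
  shows "lipschitz_above h p q"
  unfolding lipschitz_above_def
proof (intro exI[of _ C] allI impI)
  fix x y assume xy: "p \<le> x" "x \<le> y" "y \<le> q"
  show "h y - h x \<le> C * (y - x)"
  proof (rule ccontr)
    assume *: "\<not> h y - h x \<le> C * (y - x)"
    then have "0 < h y - h x - C * (y - x)" by simp
    then obtain \<eta> where \<eta>: "\<eta> > 0"
      "\<And>z. \<lbrakk>z \<in> {p..q}; dist z y < \<eta>\<rbrakk> \<Longrightarrow> dist (h z) (h y) < h y - h x - C * (y - x)"
      using cont xy unfolding continuous_on_iff by (metis atLeastAtMost_iff order_trans)
    obtain \<epsilon> where \<epsilon>: "0 < \<epsilon>" "\<epsilon> < \<eta>"
      "\<And>x. \<lbrakk>p \<le> x; x \<le> q\<rbrakk> \<Longrightarrow> h (x + \<epsilon>) - h x \<le> C * \<epsilon>"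
      using small[OF \<eta>(1)] by blast
    define n where "n = nat \<lfloor>(y - x) / \<epsilon>\<rfloor>"
    have "0 \<le> (y - x) / \<epsilon>" using xy \<epsilon>(1) by simp
    then have "real n = of_int \<lfloor>(y - x) / \<epsilon>\<rfloor>" by (simp add: n_def)
    then have "real n \<le> (y - x) / \<epsilon>" "(y - x) / \<epsilon> < real n + 1" by linarith+
    then have n: "real n * \<epsilon> \<le> y - x" "y - x < real n * \<epsilon> + \<epsilon>"
      using \<epsilon>(1) by (simp_all add: field_simps)
    have "h (x + real k * \<epsilon>) - h x \<le> C * (real k * \<epsilon>)" if "k \<le> n" for k
      using that
    proof (induction k)
      case (Suc k)
      have "real k * \<epsilon> \<le> real n * \<epsilon>" "0 \<le> real k * \<epsilon>"
        using Suc.prems \<epsilon>(1) by simp_all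
      then have "p \<le> x + real k * \<epsilon>" "x + real k * \<epsilon> \<le> q"
        using n(1) xy by linarith+
      then have "h (x + real k * \<epsilon> + \<epsilon>) - h (x + real k * \<epsilon>) \<le> C * \<epsilon>"
        by (rule \<epsilon>(3))
      with Suc show ?case by (simp add: algebra_simps)
    qed simp
    from this[of n] have "h (x + real n * \<epsilon>) - h x \<le> C * (real n * \<epsilon>)" by simp
    also have "\<dots> \<le> C * (y - x)" using n(1) \<open>0 \<le> C\<close> by (rule mult_left_mono)
    finally have 1: "h (x + real n * \<epsilon>) - h x \<le> C * (y - x)" .
    have "dist (x + real n * \<epsilon>) y < \<eta>"
      using n \<epsilon>(2) by (simp add: dist_real_def)
    moreover have "0 \<le> real n * \<epsilon>" using \<epsilon>(1) by simp
    then have "x + real n * \<epsilon> \<in> {p..q}" using n(1) xy by auto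
    ultimately have "dist (h (x + real n * \<epsilon>)) (h y) < h y - h x - C * (y - x)"
      using \<eta>(2) by blast
    then show False using 1 unfolding dist_real_def by linarith
  qed
qed

text \<open>
  The function \<open>k x = h x - C * x\<close> has \<open>k m < k a\<close>. For each of the uncountably many values \<open>v\<close> in
  between, the last point where \<open>k\<close> takes the value \<open>v\<close> is a point of the required kind, because \<open>k\<close> stays
  below \<open>v\<close> afterwards.
\<close>
lemma uncountable_dini_bounded:
  fixes h :: "real \<Rightarrow> real"
  assumes cont: "continuous_on {a..m} h" and "a < m" and C: "h m - h a < C * (m - a)"
  shows "uncountable {y. a \<le> y \<and> y < m \<and> (\<forall>z. y \<le> z \<longrightarrow> z \<le> m \<longrightarrow> h z - h y \<le> C * (z - y))}"
    (is "uncountable ?L")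
proof -
  define k where "k x = h x - C * x" for x
  have k: "continuous_on {a..m} k" unfolding k_def using cont by (intro continuous_intros)
  have km: "k m < k a" using C by (simp add: k_def algebra_simps)
  have last: "\<exists>y\<in>?L. k y = v" if v: "k m < v" "v < k a" for v
  proof -
    let ?S = "{x \<in> {a..m}. v \<le> k x}"
    have "closed ?S" using k by (intro continuous_on_closed_Collect_le) auto
    then have "compact ?S"
      using compact_Int_closed[of "{a..m}" ?S] by (simp add: Int_absorb1 subset_eq)
    moreover have "a \<in> ?S" using v \<open>a < m\<close> by auto
    ultimately obtain y where y: "y \<in> ?S" "\<And>x. x \<in> ?S \<Longrightarrow> x \<le> y"
      using compact_attains_sup[of ?S] by blast
    have "y \<noteq> m" using y(1) v by auto
    then have ym: "y < m" using y(1) by auto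
    have after: "k z < v" if "y < z" "z \<le> m" for z
      using y(2)[of z] y(1) that by force
    have "k y = v"
    proof (rule ccontr)
      assume "k y \<noteq> v"
      then have "v < k y" using y(1) by auto
      moreover have "continuous_on {y..m} k"
        using k y(1) by (auto intro: continuous_on_subset)
      ultimately obtain z where z: "y \<le> z" "z \<le> m" "k z = v"
        using IVT2'[of k m v y] v ym by auto
      then show False using after[of z] \<open>v < k y\<close> by (cases "z = y") auto
    qed
    moreover have "h z - h y \<le> C * (z - y)" if "y \<le> z" "z \<le> m" for z
    proof (cases "z = y")
      case False
      then have "k z < k y" using after[of z] that \<open>k y = v\<close> by auto
      then show ?thesis by (simp add: k_def algebra_simps)
    qed simp
    ultimately show ?thesis using y(1) ym by auto
  qed
  then have "{k m<..<k a} \<subseteq> k ` ?L" by force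
  moreover have "uncountable {k m<..<k a}" using km by (simp add: uncountable_open_interval)
  ultimately show ?thesis
    using countable_image countable_subset by blast
qed

context real_group_expansion
begin

section \<open>Nowhere Lipschitz functions\<close>

text \<open>
  The increments \<open>h (x + \<epsilon>) - h x\<close>, as functions of \<open>x\<close>, have towers of peaks. If a definable set \<open>T\<close>
  of steps \<open>\<epsilon>\<close> tends to 0, these towers can be united to a single one. Either the
  union is dense, or on some interval the increment is monotone for all small \<open>\<epsilon> \<in> T\<close>. In the latter
  case increments in one half of the interval are bounded by all increments in the other half, for
  arbitrarily small steps, and \<open>h\<close> is Lipschitz on the former half.
\<close>
lemma no_scales_if_nowhere_lipschitz:
  assumes nB: "\<not> defines_B R"
    and h: "dpred (\<lambda>e. e 0 = h (e 1))" and cont: "continuous_on {a..b} h"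
    and mono: "mono_on {a..b} h" and ab: "a < b"
    and nL: "\<And>p q. \<lbrakk>a \<le> p; p < q; q \<le> b\<rbrakk> \<Longrightarrow> \<not> lipschitz_above h p q"
    and T: "dpred (\<lambda>e. e 0 \<in> T)" and T_fin: "\<And>\<delta>. 0 < \<delta> \<Longrightarrow> finite (T \<inter> {\<delta>..})"
    and T_small: "\<And>\<delta>. 0 < \<delta> \<Longrightarrow> \<exists>\<epsilon>\<in>T. 0 < \<epsilon> \<and> \<epsilon> < \<delta>"
  shows False
proof -
  define m where "m = (a + b) / 2"
  have m: "a < m" "m < b" "b - m = m - a" using ab by (simp_all add: m_def field_simps)
  let ?g = "\<lambda>\<epsilon> x. h (x + \<epsilon>) - h x"
  define F where "F \<delta> = {x. \<exists>\<epsilon>. \<epsilon> \<in> T \<and> \<delta> \<le> \<epsilon> \<and> \<epsilon> \<le> b - m \<and>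
      (x \<in> peaks (?g \<epsilon>) a m \<delta> \<or> x \<in> peaks (\<lambda>x. - ?g \<epsilon> x) a m \<delta>)}" for \<delta>
  have "tower F"
    unfolding tower_def
  proof (intro conjI allI impI)
    show "dpred (\<lambda>e. e 1 \<in> F (e 0))"
      unfolding F_def peaks_def mem_Collect_eq
      by (intro definable_intros definable_term_app[OF h] definable_pred_mem[OF T])
    show "finite (F \<delta>)" if "0 < \<delta>" for \<delta>
    proof (rule finite_subset)
      show "F \<delta> \<subseteq> (\<Union>\<epsilon>\<in>T \<inter> {\<delta>..}. peaks (?g \<epsilon>) a m \<delta> \<union> peaks (\<lambda>x. - ?g \<epsilon> x) a m \<delta>)"
        unfolding F_def by auto
      show "finite \<dots>" using T_fin[OF that] that by (auto simp: finite_peaks)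
    qed
    show "F j \<subseteq> F i" if "i \<le> j" for i j
      unfolding F_def using peaks_antimono[OF that] that by (blast intro: order_trans)
  qed
  with nB obtain p q where pq: "a \<le> p" "p < q" "q \<le> m"
    and no_peak: "\<And>i x. \<lbrakk>0 < i; x \<in> F i\<rbrakk> \<Longrightarrow> \<not> (p < x \<and> x < q)"
    using dense_tower_defines_B[OF _ m(1)] by blast
  have monotone: "mono_on {p..q} (?g \<epsilon>) \<or> mono_on {p..q} (\<lambda>x. - ?g \<epsilon> x)"
    if \<epsilon>: "\<epsilon> \<in> T" "0 < \<epsilon>" "\<epsilon> \<le> b - m" for \<epsilon>
  proof (rule monotone_if_no_peaks[where a = a and b = m])
    show "continuous_on {p..q} (?g \<epsilon>)"
      using pq \<epsilon> m by (intro continuous_intros continuous_on_compose2[OF cont]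
          continuous_on_subset[OF cont]) auto
    fix \<delta> x :: real assume x: "0 < \<delta>" "p < x" "x < q"
    \<comment> \<open>The index \<open>\<delta>\<close> of \<open>F\<close> admits only steps \<open>\<epsilon> \<ge> \<delta>\<close>; a smaller radius is harmless, as it gives more peaks.\<close>
    have "x \<notin> F (min \<delta> \<epsilon>)" using no_peak[of "min \<delta> \<epsilon>" x] x \<epsilon> by auto
    then have "x \<notin> peaks (?g \<epsilon>) a m (min \<delta> \<epsilon>)" "x \<notin> peaks (\<lambda>x. - ?g \<epsilon> x) a m (min \<delta> \<epsilon>)"
      using \<epsilon> by (auto simp: F_def)
    then show "x \<notin> peaks (?g \<epsilon>) a m \<delta> \<and> x \<notin> peaks (\<lambda>x. - ?g \<epsilon> x) a m \<delta>"
      using peaks_antimono[of "min \<delta> \<epsilon>" \<delta>] by auto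
  qed (use pq in auto)
  define r where "r = (p + q) / 2"
  have r: "p < r" "r < q" using pq by (simp_all add: r_def)
  have H: "h z - h s \<le> h b - h a" "0 \<le> h b - h a" if "p \<le> s" "s \<le> z" "z \<le> q" for s z
    using mono_onD[OF mono, of a s] mono_onD[OF mono, of z b] mono_onD[OF mono, of a b] that pq m
    by auto
  \<comment> \<open>Increments on \<open>[s', t']\<close> are dominated by those on \<open>[s, t]\<close> for arbitrarily small steps.\<close>
  have lip: False
    if s: "p \<le> s" "s < t" "t \<le> q" and s': "p \<le> s'" "s' < t'" "t' \<le> q"
      and small: "\<And>\<delta>. 0 < \<delta> \<Longrightarrow> \<exists>\<epsilon>. 0 < \<epsilon> \<and> \<epsilon> < \<delta> \<and>
        (\<forall>x z. s' \<le> x \<longrightarrow> x \<le> t' \<longrightarrow> s \<le> z \<longrightarrow> z \<le> t \<longrightarrow> ?g \<epsilon> x \<le> ?g \<epsilon> z)"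
    for s t s' t'
  proof -
    define C where "C = 2 * (h b - h a) / (t - s)"
    have "0 \<le> C" using H(2)[of s s] s by (simp add: C_def)
    have "lipschitz_above h s' t'"
    proof (rule lipschitz_above_if_small_increments[OF _ \<open>0 \<le> C\<close>])
      show "continuous_on {s'..t'} h" using cont s' pq m by (auto intro: continuous_on_subset)
      fix \<delta> :: real assume "0 < \<delta>"
      then have "0 < min \<delta> ((t - s) / 2)" using s by simp
      from small[OF this] obtain \<epsilon> where \<epsilon>: "0 < \<epsilon>" "\<epsilon> < \<delta>" "2 * \<epsilon> \<le> t - s"
        "\<And>x z. \<lbrakk>s' \<le> x; x \<le> t'; s \<le> z; z \<le> t\<rbrakk> \<Longrightarrow> ?g \<epsilon> x \<le> ?g \<epsilon> z" by auto
      have "?g \<epsilon> x \<le> C * \<epsilon>" if x: "s' \<le> x" "x \<le> t'" for x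
        unfolding C_def
        by (rule increment_bound_if_minimal[OF s(2) \<epsilon>(1,3)]) (use H H(2)[of s s] s x \<epsilon>(4) in auto)
      then show "\<exists>\<epsilon>. 0 < \<epsilon> \<and> \<epsilon> < \<delta> \<and> (\<forall>x. s' \<le> x \<longrightarrow> x \<le> t' \<longrightarrow> ?g \<epsilon> x \<le> C * \<epsilon>)"
        using \<epsilon>(1,2) by blast
    qed
    then show False using nL[of s' t'] s' pq m by auto
  qed
  show False
  proof (cases "\<forall>\<delta>>0. \<exists>\<epsilon>. 0 < \<epsilon> \<and> \<epsilon> < \<delta> \<and> mono_on {p..q} (?g \<epsilon>)")
    case True
    show False
    proof (rule lip[of r q p r])
      fix \<delta> :: real assume "0 < \<delta>"
      then obtain \<epsilon> where \<epsilon>: "0 < \<epsilon>" "\<epsilon> < \<delta>" "mono_on {p..q} (?g \<epsilon>)" using True by blast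
      have "?g \<epsilon> x \<le> ?g \<epsilon> z" if "p \<le> x" "x \<le> r" "r \<le> z" "z \<le> q" for x z
        using mono_onD[OF \<epsilon>(3), of x z] that r by auto
      then show "\<exists>\<epsilon>. 0 < \<epsilon> \<and> \<epsilon> < \<delta> \<and>
          (\<forall>x z. p \<le> x \<longrightarrow> x \<le> r \<longrightarrow> r \<le> z \<longrightarrow> z \<le> q \<longrightarrow> ?g \<epsilon> x \<le> ?g \<epsilon> z)"
        using \<epsilon> by blast
    qed (use r in auto)
  next
    case False
    then obtain \<delta>0 where \<delta>0: "0 < \<delta>0" "\<And>\<epsilon>. \<lbrakk>0 < \<epsilon>; \<epsilon> < \<delta>0\<rbrakk> \<Longrightarrow> \<not> mono_on {p..q} (?g \<epsilon>)" by blast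
    show False
    proof (rule lip[of p r r q])
      fix \<delta> :: real assume "0 < \<delta>"
      then obtain \<epsilon> where \<epsilon>: "\<epsilon> \<in> T" "0 < \<epsilon>" "\<epsilon> < min (min \<delta> \<delta>0) (b - m)"
        using T_small[of "min (min \<delta> \<delta>0) (b - m)"] \<delta>0(1) m by auto
      then have anti: "mono_on {p..q} (\<lambda>x. - ?g \<epsilon> x)" using monotone[of \<epsilon>] \<delta>0(2)[of \<epsilon>] by auto
      have "?g \<epsilon> x \<le> ?g \<epsilon> z" if "r \<le> x" "x \<le> q" "p \<le> z" "z \<le> r" for x z
        using mono_onD[OF anti, of z x] that r by auto
      then show "\<exists>\<epsilon>. 0 < \<epsilon> \<and> \<epsilon> < \<delta> \<and>
          (\<forall>x z. r \<le> x \<longrightarrow> x \<le> q \<longrightarrow> p \<le> z \<longrightarrow> z \<le> r \<longrightarrow> ?g \<epsilon> x \<le> ?g \<epsilon> z)"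
        using \<epsilon> by (intro exI[of _ \<epsilon>]) auto
    qed (use r in auto)
  qed
qed

text \<open>
  The indices at which new points of the tower appear are definable.
\<close>
lemma scales_of_growing_tower:
  assumes A: "tower A" and grow: "\<And>\<delta>. 0 < \<delta> \<Longrightarrow> \<exists>\<delta>'>0. \<not> A \<delta>' \<subseteq> A \<delta>"
  obtains T where "dpred (\<lambda>e. e 0 \<in> T)" "\<And>\<delta>. 0 < \<delta> \<Longrightarrow> finite (T \<inter> {\<delta>..})"
    "\<And>\<delta>. 0 < \<delta> \<Longrightarrow> \<exists>\<epsilon>\<in>T. 0 < \<epsilon> \<and> \<epsilon> < \<delta>"
proof -
  \<comment> \<open>\<open>\<tau>\<close> is the supremum of the indices of the sets that contain \<open>x\<close>; whether \<open>x \<in> A \<tau>\<close> is left open.\<close>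
  define J where "J \<tau> x \<longleftrightarrow> (\<forall>\<delta>. 0 < \<delta> \<longrightarrow> \<delta> < \<tau> \<longrightarrow> x \<in> A \<delta>) \<and> (\<forall>\<delta>. \<tau> < \<delta> \<longrightarrow> x \<notin> A \<delta>)" for \<tau> x
  define T where "T = {\<tau>. 0 < \<tau> \<and> (\<exists>x. J \<tau> x)}"
  have "dpred (\<lambda>e. e 0 \<in> T)"
    unfolding T_def J_def mem_Collect_eq by (intro definable_intros dpred_tower[OF A])
  moreover have "finite (T \<inter> {\<delta>..})" if "0 < \<delta>" for \<delta>
  proof -
    define x where "x \<tau> = (SOME x. J \<tau> x)" for \<tau>
    have x: "J \<tau> (x \<tau>)" if "\<tau> \<in> T" for \<tau>
      using that unfolding T_def x_def by (auto intro: someI)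
    have "inj_on x T"
    proof (rule linorder_inj_onI)
      fix \<sigma> \<tau> assume "\<sigma> < \<tau>" and st: "\<sigma> \<in> T" "\<tau> \<in> T"
      then obtain \<delta> where \<delta>: "\<sigma> < \<delta>" "\<delta> < \<tau>" using dense by blast
      moreover have "0 < \<sigma>" using st by (simp add: T_def)
      ultimately have "x \<sigma> \<notin> A \<delta>" "x \<tau> \<in> A \<delta>"
        using x[OF st(1)] x[OF st(2)] unfolding J_def by auto
      then show "x \<sigma> \<noteq> x \<tau>" by auto
    qed auto
    then have "inj_on x (T \<inter> {\<delta>..})" by (rule inj_on_subset) auto
    moreover have "x ` (T \<inter> {\<delta>..}) \<subseteq> A (\<delta> / 2)"
      using x that unfolding J_def by auto
    moreover have "finite (A (\<delta> / 2))" using towerD(2)[OF A, of "\<delta> / 2"] that by simp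
    ultimately show ?thesis
      using finite_imageD finite_subset by blast
  qed
  moreover have "\<exists>\<epsilon>\<in>T. 0 < \<epsilon> \<and> \<epsilon> < \<delta>" if \<delta>: "0 < \<delta>" for \<delta>
  proof -
    \<comment> \<open>A point that appears only after index \<open>\<delta> / 2\<close> has its supremum at most there.\<close>
    obtain \<delta>' x where \<delta>': "0 < \<delta>'" "x \<in> A \<delta>'" "x \<notin> A (\<delta> / 2)"
      using grow[of "\<delta> / 2"] \<delta> by auto
    let ?S = "{s. 0 < s \<and> x \<in> A s}"
    define \<tau> where "\<tau> = Sup ?S"
    have less: "s < \<delta> / 2" if "s \<in> ?S" for s
    proof (rule ccontr)
      assume "\<not> s < \<delta> / 2"
      then show False using towerD(3)[OF A, of "\<delta> / 2" s] \<open>0 < \<delta>\<close> that \<delta>'(3) by auto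
    qed
    then have bdd: "bdd_above ?S" by (intro bdd_aboveI[of _ "\<delta> / 2"]) (auto intro: less_imp_le)
    have mem: "\<delta>' \<in> ?S" using \<delta>' by simp
    then have "\<delta>' \<le> \<tau>" unfolding \<tau>_def using bdd by (rule cSup_upper)
    then have pos: "0 < \<tau>" using \<delta>'(1) by simp
    have "\<tau> \<le> \<delta> / 2" unfolding \<tau>_def using mem less by (intro cSup_least) (auto intro: less_imp_le)
    have "J \<tau> x"
      unfolding J_def
    proof (intro conjI allI impI)
      fix s assume "0 < s" "s < \<tau>"
      then obtain u where "u \<in> ?S" "s < u"
        using less_cSupD[of ?S s] mem unfolding \<tau>_def by auto
      then show "x \<in> A s" using towerD(3)[OF A, of s u] \<open>0 < s\<close> by auto
    next
      fix s assume "\<tau> < s"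
      then show "x \<notin> A s"
        using cSup_upper[OF _ bdd, of s] pos unfolding \<tau>_def by force
    qed
    then show ?thesis
      using pos \<open>\<tau> \<le> \<delta> / 2\<close> that unfolding T_def by (intro bexI[of _ \<tau>]) auto
  qed
  ultimately show thesis by (rule that)
qed

text \<open>
  The tame case: there is no infinite discrete information at all, as in an o-minimal structure.
\<close>
definition towers_stabilise :: bool where
  "towers_stabilise \<longleftrightarrow> (\<forall>A. tower A \<longrightarrow> (\<exists>\<delta>0>0. \<forall>\<delta>>0. A \<delta> \<subseteq> A \<delta>0))"

text \<open>
  The gaps of a bounded closed set form a tower, indexed by their length. In the tame case gap
  lengths are bounded away from 0, that is, the set has finitely many components.
\<close>
lemma gap_bound:
  assumes st: towers_stabilise
    and A: "dpred (\<lambda>e. e 0 \<in> A)" "closed A" "A \<subseteq> {a..b}"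
  obtains \<delta>0 where "0 < \<delta>0"
    "\<And>x y z. \<lbrakk>x \<in> A; y \<in> A; z \<notin> A; x < z; z < y\<rbrakk> \<Longrightarrow> \<delta>0 \<le> y - x"
proof -
  define G where "G \<delta> = {x. x \<in> A \<and> (\<exists>y. y \<in> A \<and> x < y \<and> x + \<delta> \<le> y \<and>
      (\<forall>z. x < z \<longrightarrow> z < y \<longrightarrow> z \<notin> A))}" for \<delta>
  have "tower G"
    unfolding tower_def
  proof (intro conjI allI impI)
    show "dpred (\<lambda>e. e 1 \<in> G (e 0))"
      unfolding G_def mem_Collect_eq by (intro definable_intros definable_pred_mem[OF A(1)])
    show "finite (G \<delta>)" if "0 < \<delta>" for \<delta>
    proof (rule finite_separated[OF _ that])
      show "G \<delta> \<subseteq> {a..b}" using A(3) by (auto simp: G_def)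
      fix x y assume xy: "x \<in> G \<delta>" "y \<in> G \<delta>" "x < y"
      then obtain y' where y': "x + \<delta> \<le> y'" "\<And>z. \<lbrakk>x < z; z < y'\<rbrakk> \<Longrightarrow> z \<notin> A"
        unfolding G_def by blast
      have "y \<in> A" using xy by (simp add: G_def)
      then have "y' \<le> y" using y'(2)[of y] xy by force
      then show "\<delta> \<le> y - x" using y' by simp
    qed
    show "G j \<subseteq> G i" if "i \<le> j" for i j
    proof
      fix x assume "x \<in> G j"
      then obtain y where "x \<in> A" "y \<in> A" "x < y" "x + j \<le> y" "\<forall>z. x < z \<longrightarrow> z < y \<longrightarrow> z \<notin> A"
        by (auto simp: G_def)
      moreover from this have "x + i \<le> y" using that by simp
      ultimately show "x \<in> G i" unfolding G_def by blast
    qed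
  qed
  then obtain \<delta>0 where \<delta>0: "\<delta>0 > 0" "\<And>\<delta>. 0 < \<delta> \<Longrightarrow> G \<delta> \<subseteq> G \<delta>0"
    using st unfolding towers_stabilise_def by blast
  have "\<delta>0 \<le> y - x" if xyz: "x \<in> A" "y \<in> A" "z \<notin> A" "x < z" "z < y" for x y z
  proof -
    \<comment> \<open>The gap around \<open>z\<close> lies between \<open>x\<close> and \<open>y\<close>.\<close>
    have "compact (A \<inter> {x..z})" "compact (A \<inter> {z..y})"
      using A(2) by (simp_all add: closed_Int_compact)
    moreover have "x \<in> A \<inter> {x..z}" "y \<in> A \<inter> {z..y}" using xyz by auto
    ultimately obtain u v where u: "u \<in> A \<inter> {x..z}" "\<And>w. w \<in> A \<inter> {x..z} \<Longrightarrow> w \<le> u"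
      and v: "v \<in> A \<inter> {z..y}" "\<And>w. w \<in> A \<inter> {z..y} \<Longrightarrow> v \<le> w"
      using compact_attains_sup compact_attains_inf by (metis empty_iff)
    have uv: "u < z" "z < v" using u(1) v(1) xyz(3) by (auto simp: less_le)
    have gap: "w \<notin> A" if "u < w" "w < v" for w
      using u(2)[of w] v(2)[of w] u(1) v(1) that by (cases "w \<le> z") auto
    have "u \<in> G (v - u)" unfolding G_def using u(1) v(1) uv gap by auto
    then have "u \<in> G \<delta>0" using \<delta>0(2)[of "v - u"] uv by auto
    then obtain v' where v': "v' \<in> A" "u < v'" "u + \<delta>0 \<le> v'" "\<And>w. \<lbrakk>u < w; w < v'\<rbrakk> \<Longrightarrow> w \<notin> A"
      unfolding G_def by blast
    have "v' \<le> v" using v'(4)[of v] v(1) uv by force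
    then show ?thesis using v'(3) u(1) v(1) by auto
  qed
  then show thesis using that \<delta>0(1) by blast
qed

text \<open>
  Suppose that \<open>h\<close> is nowhere Lipschitz, so that towers stabilise by the lemmas above. Compare points
  by the germs at \<open>t = 0\<close> of the increments \<open>h (x + t) - h x\<close>. Here \<open>P y\<close> is the set of the points \<open>x\<close>
  whose germ is at most that of \<open>y\<close>. This is a total preorder: the difference of two germs has a
  constant sign near 0, as the set where it is at most 0 has no short gaps. If the increments at \<open>y\<close>
  are bounded by \<open>C * t\<close>, then so are those of all points of \<open>P y\<close>, and \<open>P y\<close> is a union of a tower of
  closed sets \<open>S y \<delta>\<close>, which are finite because an interval in one of them would be an interval on
  which \<open>h\<close> is Lipschitz. Hence \<open>P y\<close> is finite. But a total preorder with finite initial segments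
  is countable, whereas there are uncountably many such \<open>y\<close>.
\<close>
lemma lipschitz_somewhere:
  assumes nB: "\<not> defines_B R"
    and h: "dpred (\<lambda>e. e 0 = h (e 1))" and cont: "continuous_on {a..b} h"
    and mono: "mono_on {a..b} h" and ab: "a < b"
  shows "\<exists>p q. a \<le> p \<and> p < q \<and> q \<le> b \<and> lipschitz_above h p q"
proof (rule ccontr)
  assume "\<not> ?thesis"
  then have nL: "\<And>p q. \<lbrakk>a \<le> p; p < q; q \<le> b\<rbrakk> \<Longrightarrow> \<not> lipschitz_above h p q" by blast
  have st: towers_stabilise
    unfolding towers_stabilise_def
  proof (intro allI impI, rule ccontr)
    fix A assume A: "tower A" and "\<not> (\<exists>\<delta>0>0. \<forall>\<delta>>0. A \<delta> \<subseteq> A \<delta>0)"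
    then have "\<And>\<delta>. 0 < \<delta> \<Longrightarrow> \<exists>\<delta>'>0. \<not> A \<delta>' \<subseteq> A \<delta>" by blast
    from scales_of_growing_tower[OF A this] obtain T where "dpred (\<lambda>e. e 0 \<in> T)"
      "\<And>\<delta>. 0 < \<delta> \<Longrightarrow> finite (T \<inter> {\<delta>..})" "\<And>\<delta>. 0 < \<delta> \<Longrightarrow> \<exists>\<epsilon>\<in>T. 0 < \<epsilon> \<and> \<epsilon> < \<delta>"
      by blast
    from no_scales_if_nowhere_lipschitz[OF nB h cont mono ab nL this] show False .
  qed
  define m where "m = (a + b) / 2"
  have m: "a < m" "m < b" "b - m = m - a" using ab by (simp_all add: m_def field_simps)
  define S where "S y \<delta> = {x. a \<le> x \<and> x \<le> m \<and>
      (\<forall>t. 0 \<le> t \<longrightarrow> t \<le> \<delta> \<longrightarrow> t \<le> b - m \<longrightarrow> h (x + t) - h x \<le> h (y + t) - h y)}" for y \<delta>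
  have S_pred: "dpred (\<lambda>e. e 1 \<in> S y (e 0))" and S_pred0: "dpred (\<lambda>e. e 0 \<in> S y \<delta>)" for y \<delta>
    unfolding S_def mem_Collect_eq by (intro definable_intros definable_term_app[OF h])+
  have S_anti: "S y \<delta>' \<subseteq> S y \<delta>" if "\<delta> \<le> \<delta>'" for y \<delta> \<delta>'
    using that by (auto simp: S_def)
  have S_closed: "closed (S y \<delta>)" for y \<delta>
  proof -
    have "S y \<delta> = {a..m} \<inter> (\<Inter>t\<in>{t. 0 \<le> t \<and> t \<le> \<delta> \<and> t \<le> b - m}.
        {x \<in> {a..m}. h (x + t) - h x \<le> h (y + t) - h y})"
      by (auto simp: S_def)
    moreover have "closed {x \<in> {a..m}. h (x + t) - h x \<le> h (y + t) - h y}"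
      if "0 \<le> t" "t \<le> b - m" for t
    proof (rule continuous_on_closed_Collect_le)
      show "continuous_on {a..m} (\<lambda>x. h (x + t) - h x)"
        using that m by (intro continuous_intros continuous_on_compose2[OF cont]
            continuous_on_subset[OF cont]) auto
    qed auto
    ultimately show ?thesis by (auto intro!: closed_Int closed_INT)
  qed
  \<comment> \<open>Any constant above the mean slope on \<open>[a, m]\<close> would do.\<close>
  define C where "C = (h m - h a) / (m - a) + 1"
  define L where "L = {y. a \<le> y \<and> y < m \<and> (\<forall>z. y \<le> z \<longrightarrow> z \<le> m \<longrightarrow> h z - h y \<le> C * (z - y))}"
  have "continuous_on {a..m} h" using cont m by (auto intro: continuous_on_subset)
  moreover have "h m - h a < C * (m - a)" using m by (simp add: C_def distrib_right)
  ultimately have unc: "uncountable L"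
    unfolding L_def using m by (intro uncountable_dini_bounded) auto

  have S_fin: "finite (S y \<delta>)" if y: "y \<in> L" and "0 < \<delta>" for y \<delta>
  proof -
    \<comment> \<open>For \<open>t \<le> m - y\<close> the increment at \<open>y\<close> is bounded by \<open>C * t\<close>.\<close>
    define \<delta>1 where "\<delta>1 = min \<delta> (m - y)"
    have \<delta>1: "0 < \<delta>1" "\<delta>1 \<le> \<delta>" "\<delta>1 \<le> m - y" "\<delta>1 \<le> b - m"
      using y \<open>0 < \<delta>\<close> m by (auto simp: \<delta>1_def L_def)
    have sub: "S y \<delta>1 \<subseteq> {a..m}" by (auto simp: S_def)
    obtain \<delta>0 where \<delta>0: "0 < \<delta>0"
      "\<And>x x' z. \<lbrakk>x \<in> S y \<delta>1; x' \<in> S y \<delta>1; z \<notin> S y \<delta>1; x < z; z < x'\<rbrakk> \<Longrightarrow> \<delta>0 \<le> x' - x"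
      using gap_bound[OF st S_pred0 S_closed sub] by blast
    have "finite (S y \<delta>1)"
    proof (rule finite_separated[OF sub \<delta>0(1)])
      fix x x' assume x: "x \<in> S y \<delta>1" "x' \<in> S y \<delta>1" "x < x'"
      show "\<delta>0 \<le> x' - x"
      proof (rule ccontr)
        assume "\<not> \<delta>0 \<le> x' - x"
        then have fill: "z \<in> S y \<delta>1" if "x \<le> z" "z \<le> x'" for z
          using \<delta>0(2)[OF x(1,2), of z] x(1,2) that by (cases "z = x"; cases "z = x'") auto
        define x'' where "x'' = min x' (x + \<delta>1)"
        have "lipschitz_above h x x''"
          unfolding lipschitz_above_def
        proof (intro exI[of _ C] allI impI)
          fix u v assume uv: "x \<le> u" "u \<le> v" "v \<le> x''"
          then have "u \<in> S y \<delta>1" using fill by (simp add: x''_def)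
          moreover have t: "0 \<le> v - u" "v - u \<le> \<delta>1" "v - u \<le> b - m"
            using uv \<delta>1 by (auto simp: x''_def)
          ultimately have "h (u + (v - u)) - h u \<le> h (y + (v - u)) - h y"
            unfolding S_def by blast
          moreover have "h (y + (v - u)) - h y \<le> C * (y + (v - u) - y)"
          proof -
            have "y \<le> y + (v - u)" "y + (v - u) \<le> m" using t \<delta>1(3) by linarith+
            then show ?thesis using y unfolding L_def by blast
          qed
          ultimately show "h v - h u \<le> C * (v - u)" by simp
        qed
        moreover have "a \<le> x" "x < x''" "x'' \<le> b"
          using x(3) subsetD[OF sub x(1)] subsetD[OF sub x(2)] \<delta>1(1) m by (auto simp: x''_def)
        ultimately show False using nL by blast
      qed
    qed
    then show ?thesis using S_anti[OF \<delta>1(2)] finite_subset by blast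
  qed

  define P where "P y = (\<Union>\<delta>\<in>{0<..}. S y \<delta>)" for y
  have P_fin: "finite (P y)" if "y \<in> L" for y
  proof -
    have "tower (S y)"
      unfolding tower_def using S_pred S_fin[OF that] S_anti by blast
    then obtain \<delta>0 where "\<delta>0 > 0" "\<And>\<delta>. 0 < \<delta> \<Longrightarrow> S y \<delta> \<subseteq> S y \<delta>0"
      using st unfolding towers_stabilise_def by blast
    then have "P y \<subseteq> S y \<delta>0" by (auto simp: P_def)
    then show ?thesis using S_fin[OF that \<open>\<delta>0 > 0\<close>] finite_subset by blast
  qed
  have total: "x \<in> P y \<or> y \<in> P x" if x: "a \<le> x" "x \<le> m" and y: "a \<le> y" "y \<le> m" for x y
  proof (rule ccontr)
    assume *: "\<not> ?thesis"
    define k where "k t = (h (x + t) - h x) - (h (y + t) - h y)" for t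
    have up: "\<exists>t. 0 \<le> t \<and> t \<le> \<delta> \<and> t \<le> b - m \<and> 0 < k t" if "0 < \<delta>" for \<delta>
    proof -
      have "x \<notin> S y \<delta>" using * that by (auto simp: P_def)
      then show ?thesis using x unfolding S_def k_def by force
    qed
    have down: "\<exists>t. 0 \<le> t \<and> t \<le> \<delta> \<and> t \<le> b - m \<and> k t < 0" if "0 < \<delta>" for \<delta>
    proof -
      have "y \<notin> S x \<delta>" using * that by (auto simp: P_def)
      then show ?thesis using y unfolding S_def k_def by force
    qed
    let ?A = "{t \<in> {0..b - m}. k t \<le> 0}"
    have "closed ?A"
    proof (rule continuous_on_closed_Collect_le)
      show "continuous_on {0..b - m} k"
        unfolding k_def using x y m
        by (intro continuous_intros continuous_on_compose2[OF cont]) auto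
    qed auto
    moreover have "dpred (\<lambda>e. e 0 \<in> ?A)"
      unfolding k_def mem_Collect_eq atLeastAtMost_iff
      by (intro definable_intros definable_term_app[OF h])
    moreover have "?A \<subseteq> {0..b - m}" by auto
    ultimately obtain \<delta>0 where \<delta>0: "0 < \<delta>0"
      "\<And>s t z. \<lbrakk>s \<in> ?A; t \<in> ?A; z \<notin> ?A; s < z; z < t\<rbrakk> \<Longrightarrow> \<delta>0 \<le> t - s"
      using gap_bound[OF st] by blast
    \<comment> \<open>A positive value at \<open>z\<close> between 0 and a negative value at \<open>t\<close> makes a gap that is too short.\<close>
    obtain t where t: "0 \<le> t" "t \<le> \<delta>0 / 2" "t \<le> b - m" "k t < 0"
      using down[of "\<delta>0 / 2"] \<delta>0(1) by auto
    have "k 0 = 0" by (simp add: k_def)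
    then have "0 < t" using t by (cases "t = 0") auto
    then obtain z where z: "0 \<le> z" "z \<le> t / 2" "0 < k z" using up[of "t / 2"] by auto
    have "0 < z" using z \<open>k 0 = 0\<close> by (cases "z = 0") auto
    have "\<delta>0 \<le> t - 0"
      using t z \<open>0 < z\<close> \<open>0 < t\<close> \<open>k 0 = 0\<close> m by (intro \<delta>0(2)[of 0 t z]) auto
    then show False using t \<delta>0(1) by simp
  qed
  have trans: "P x \<subseteq> P y" if xy: "x \<in> P y" for x y
  proof
    fix w assume "w \<in> P x"
    then obtain \<delta> \<delta>' where \<delta>: "0 < \<delta>" "x \<in> S y \<delta>" "0 < \<delta>'" "w \<in> S x \<delta>'"
      using xy by (auto simp: P_def)
    have "h (w + t) - h w \<le> h (y + t) - h y" if t: "0 \<le> t" "t \<le> min \<delta> \<delta>'" "t \<le> b - m" for t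
    proof -
      have "h (w + t) - h w \<le> h (x + t) - h x" using \<delta>(4) t by (auto simp: S_def)
      also have "\<dots> \<le> h (y + t) - h y" using \<delta>(2) t by (auto simp: S_def)
      finally show ?thesis .
    qed
    then have "w \<in> S y (min \<delta> \<delta>')" using \<delta>(4) by (auto simp: S_def)
    then show "w \<in> P y" using \<delta> by (auto simp: P_def)
  qed
  have self: "y \<in> P y" if "y \<in> L" for y
    using that by (auto simp: P_def S_def L_def intro!: exI[of _ 1])
  have "finite {y \<in> L. card (P y) = n}" for n
  proof (cases "{y \<in> L. card (P y) = n} = {}")
    case False
    then obtain y where y: "y \<in> L" "card (P y) = n" by blast
    have "y' \<in> P y" if y': "y' \<in> L" "card (P y') = n" for y'
    proof -
      have "y' \<in> P y \<or> y \<in> P y'" using total[of y' y] y y' by (auto simp: L_def)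
      then show ?thesis
      proof
        assume "y \<in> P y'"
        then have "P y = P y'"
          using trans P_fin[OF y'(1)] y(2) y'(2) by (intro card_subset_eq) auto
        then show ?thesis using self[OF y'(1)] by simp
      qed
    qed
    then have "{y \<in> L. card (P y) = n} \<subseteq> P y" by auto
    then show ?thesis by (rule finite_subset) (rule P_fin[OF y(1)])
  qed (metis finite.emptyI)
  then have "countable (\<Union>n. {y \<in> L. card (P y) = n})"
    by (intro countable_UN) (auto intro: countable_finite)
  moreover have "(\<Union>n. {y \<in> L. card (P y) = n}) = L" by auto
  ultimately show False using unc by simp
qed

end

section \<open>Bi-Lipschitz pieces\<close>

lemma bi_lipschitz_on_if_bounds:
  fixes f :: "real \<Rightarrow> real"
  assumes upper: "\<And>x y. \<lbrakk>p \<le> x; x \<le> y; y \<le> q\<rbrakk> \<Longrightarrow> f y - f x \<le> C * (y - x)"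
    and lower: "\<And>x y. \<lbrakk>p \<le> x; x \<le> y; y \<le> q\<rbrakk> \<Longrightarrow> y - x \<le> C' * (f y - f x)"
    and mono: "mono_on {p..q} f"
  shows "bi_lipschitz_on {p..q} f"
proof -
  define c where "c = max 1 (max C C')"
  have c: "0 < c" "C \<le> c" "C' \<le> c" by (auto simp: c_def)
  have bounds: "1 / c * \<bar>x - y\<bar> \<le> \<bar>f x - f y\<bar> \<and> \<bar>f x - f y\<bar> \<le> c * \<bar>x - y\<bar>"
    if "p \<le> x" "x \<le> y" "y \<le> q" for x y
  proof -
    have "f x \<le> f y" using mono_onD[OF mono, of x y] that by auto
    then have abs: "\<bar>f x - f y\<bar> = f y - f x" "\<bar>x - y\<bar> = y - x" using that by auto
    have "f y - f x \<le> c * (y - x)"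
      using upper[OF that] mult_right_mono[OF c(2), of "y - x"] that by linarith
    moreover have "y - x \<le> c * (f y - f x)"
      using lower[OF that] mult_right_mono[OF c(3), of "f y - f x"] \<open>f x \<le> f y\<close> by linarith
    ultimately show ?thesis
      unfolding abs using c(1) by (simp add: field_simps)
  qed
  show ?thesis
    unfolding bi_lipschitz_on_def
  proof (intro exI[of _ c] conjI ballI)
    fix x y assume "x \<in> {p..q}" "y \<in> {p..q}"
    then show "1 / c * \<bar>x - y\<bar> \<le> \<bar>f x - f y\<bar>" "\<bar>f x - f y\<bar> \<le> c * \<bar>x - y\<bar>"
      using bounds[of x y] bounds[of y x] by (cases "x \<le> y"; auto simp: abs_minus_commute)+
  qed (rule c(1))
qed

lemma bi_lipschitz_on_uminus: "bi_lipschitz_on X (\<lambda>x. - f x) \<longleftrightarrow> bi_lipschitz_on X f"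
proof -
  have "\<bar>- f x - - f y\<bar> = \<bar>f x - f y\<bar>" for x y by linarith
  then show ?thesis unfolding bi_lipschitz_on_def by simp
qed

lemma bi_lipschitz_on_subset: "bi_lipschitz_on X f \<Longrightarrow> Y \<subseteq> X \<Longrightarrow> bi_lipschitz_on Y f"
  unfolding bi_lipschitz_on_def by blast

context real_group_expansion
begin

text \<open>
  A subinterval on which \<open>f\<close> is Lipschitz is mapped onto an interval, on some part of which the
  inverse function is Lipschitz for the same reason.
\<close>
lemma bi_lipschitz_somewhere:
  assumes nB: "\<not> defines_B R"
    and f: "dpred (\<lambda>e. e 0 = f (e 1))" and cont: "continuous_on {a..b} f"
    and mono: "strict_mono_on {a..b} f" and ab: "a < b"
  shows "\<exists>p q. a \<le> p \<and> p < q \<and> q \<le> b \<and> bi_lipschitz_on {p..q} f"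
proof -
  have less: "f x < f y" if "a \<le> x" "x < y" "y \<le> b" for x y
    using strict_mono_onD[OF mono, of x y] that by auto
  have le: "f x \<le> f y" if "a \<le> x" "x \<le> y" "y \<le> b" for x y
    using less[of x y] that by (cases "x = y") auto
  have mono': "mono_on {a..b} f" using le by (auto intro: mono_onI)
  obtain p q where pq: "a \<le> p" "p < q" "q \<le> b" "lipschitz_above f p q"
    using lipschitz_somewhere[OF nB f cont mono' ab] by blast
  then obtain C where C: "\<And>x y. \<lbrakk>p \<le> x; x \<le> y; y \<le> q\<rbrakk> \<Longrightarrow> f y - f x \<le> C * (y - x)"
    unfolding lipschitz_above_def by blast
  have contpq: "continuous_on {p..q} f" using cont pq by (auto intro: continuous_on_subset)
  have inj: "x = y" if "p \<le> x" "x \<le> q" "p \<le> y" "y \<le> q" "f x = f y" for x y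
    using less[of x y] less[of y x] that pq by (cases x y rule: linorder_cases) auto
  have img: "f ` {p..q} = {f p..f q}"
  proof (intro equalityI subsetI)
    fix y assume "y \<in> {f p..f q}"
    then obtain x where "p \<le> x" "x \<le> q" "f x = y" using IVT'[of f p y q] contpq pq by auto
    then show "y \<in> f ` {p..q}" by auto
  qed (use le pq in auto)
  define k where "k y = (if f p \<le> y \<and> y \<le> f q then the_inv_into {p..q} f y else 0)" for y
  have kf: "k (f x) = x" if "p \<le> x" "x \<le> q" for x
  proof -
    have "f p \<le> f x" "f x \<le> f q" using le that pq by auto
    then show ?thesis
      unfolding k_def using that inj by (simp add: the_inv_into_f_f inj_on_def)
  qed
  have k_in: "p \<le> k y \<and> k y \<le> q \<and> f (k y) = y" if "f p \<le> y" "y \<le> f q" for y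
  proof -
    have "y \<in> f ` {p..q}" using that img by simp
    then obtain x where "p \<le> x" "x \<le> q" "y = f x" by auto
    then show ?thesis using kf[of x] by simp
  qed
  have k_graph: "x = k y \<longleftrightarrow> p \<le> x \<and> x \<le> q \<and> f x = y \<or> \<not> (f p \<le> y \<and> y \<le> f q) \<and> x = 0" for x y
  proof (cases "f p \<le> y \<and> y \<le> f q")
    case True
    then show ?thesis using k_in[of y] inj[of x "k y"] by auto
  next
    case False
    then show ?thesis using le pq by (auto simp: k_def)
  qed
  have k_pred: "dpred (\<lambda>e. e 0 = k (e 1))"
    unfolding k_graph by (intro definable_intros definable_term_app[OF f])
  have k_cont: "continuous_on {f p..f q} k"
    using continuous_on_inv[OF contpq, of k] kf img by auto
  have k_less: "k x < k y" if "f p \<le> x" "x < y" "y \<le> f q" for x y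
  proof (rule ccontr)
    assume *: "\<not> k x < k y"
    have "f p \<le> y" "x \<le> f q" using that by linarith+
    then have k: "p \<le> k y" "k x \<le> q" "f (k x) = x" "f (k y) = y"
      using k_in[of x] k_in[of y] that by blast+
    have "f (k y) \<le> f (k x)" using * k(1,2) pq by (intro le) linarith+
    then show False using k that by simp
  qed
  have k_mono: "mono_on {f p..f q} k"
  proof (rule mono_onI)
    fix x y assume "x \<in> {f p..f q}" "y \<in> {f p..f q}" "x \<le> y"
    then show "k x \<le> k y" using k_less[of x y] by (cases "x = y") auto
  qed
  have "f p < f q" using less pq by auto
  from lipschitz_somewhere[OF nB k_pred k_cont k_mono this]
  obtain u v where uv: "f p \<le> u" "u < v" "v \<le> f q" "lipschitz_above k u v" by blast
  then obtain C' where C': "\<And>x y. \<lbrakk>u \<le> x; x \<le> y; y \<le> v\<rbrakk> \<Longrightarrow> k y - k x \<le> C' * (y - x)"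
    unfolding lipschitz_above_def by blast
  have ku: "p \<le> k u" "f (k u) = u" and kv: "k v \<le> q" "f (k v) = v"
    using k_in[of u] k_in[of v] uv by auto
  have "bi_lipschitz_on {k u..k v} f"
  proof (rule bi_lipschitz_on_if_bounds)
    fix x y assume xy: "k u \<le> x" "x \<le> y" "y \<le> k v"
    show "f y - f x \<le> C * (y - x)" using C xy ku kv by auto
    have "u \<le> f x" "f x \<le> f y" "f y \<le> v"
      using le[of "k u" x] le[of x y] le[of y "k v"] xy ku kv pq by auto
    from C'[OF this] show "y - x \<le> C' * (f y - f x)"
      using kf[of x] kf[of y] xy ku kv by auto
  next
    show "mono_on {k u..k v} f"
      using mono' ku kv pq by (auto intro: mono_on_subset)
  qed
  moreover have "k u < k v" using k_less uv by auto
  ultimately show ?thesis using ku kv pq by (intro exI[of _ "k u"] exI[of _ "k v"]) auto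
qed

end

definition bi_lipschitz_at :: "(real \<Rightarrow> real) \<Rightarrow> real \<Rightarrow> bool" where
  "bi_lipschitz_at f x \<longleftrightarrow> (\<exists>W. open W \<and> x \<in> W \<and> bi_lipschitz_on W f)"

lemma open_bi_lipschitz_at: "open {x. bi_lipschitz_at f x}"
  by (subst open_subopen) (auto simp: bi_lipschitz_at_def subset_eq)

lemma not_const_at_if_bi_lipschitz_at:
  assumes "bi_lipschitz_at f x"
  shows "\<not> const_at f x"
proof
  assume "const_at f x"
  then obtain \<delta> where \<delta>: "0 < \<delta>" "\<And>y. \<lbrakk>x < y; y < x + \<delta>\<rbrakk> \<Longrightarrow> f x = f y"
    using const_at_right by blast
  obtain W c where W: "open W" "x \<in> W" "c > 0"
    "\<And>u v. \<lbrakk>u \<in> W; v \<in> W\<rbrakk> \<Longrightarrow> 1 / c * \<bar>u - v\<bar> \<le> \<bar>f u - f v\<bar>"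
    using assms unfolding bi_lipschitz_at_def bi_lipschitz_on_def by blast
  obtain e where e: "0 < e" "ball x e \<subseteq> W" using W(1,2) open_contains_ball by blast
  define y where "y = x + min \<delta> e / 2"
  have "x < y" "y < x + \<delta>" "y \<in> W" using \<delta>(1) e by (auto simp: y_def dist_real_def subset_eq)
  then have "1 / c * \<bar>x - y\<bar> \<le> 0" using W(4)[of x y] W(2) \<delta>(2)[of y] by simp
  then show False using \<open>x < y\<close> W(3) by (simp add: field_simps)
qed

lemma locally_bi_lipschitz_on_if_at:
  assumes "open C" "\<And>x. x \<in> C \<Longrightarrow> bi_lipschitz_at f x"
  shows "locally_bi_lipschitz_on C f"
  unfolding locally_bi_lipschitz_on_def
proof
  fix x assume "x \<in> C"
  then obtain W where W: "open W" "x \<in> W" "bi_lipschitz_on W f"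
    using assms(2) unfolding bi_lipschitz_at_def by blast
  then show "\<exists>W. open W \<and> x \<in> W \<and> W \<subseteq> C \<and> bi_lipschitz_on W f"
    using assms(1) \<open>x \<in> C\<close> by (intro exI[of _ "W \<inter> C"]) (auto intro: bi_lipschitz_on_subset)
qed

context real_group_expansion
begin

text \<open>
  Near a point of strict monotonicity there is a bi-Lipschitz interval; for a decreasing function
  this is applied to its negative.
\<close>
lemma const_or_bi_lipschitz_dense:
  assumes nB: "\<not> defines_B R" and f: "dpred (\<lambda>e. e 0 = f (e 1))"
    and cont: "continuous_on UNIV f" and ab: "a < b"
  shows "\<exists>x. a < x \<and> x < b \<and> (const_at f x \<or> bi_lipschitz_at f x)"
proof -
  have incr: "\<exists>y. a < y \<and> y < b \<and> bi_lipschitz_at g y"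
    if g: "dpred (\<lambda>e. e 0 = g (e 1))" "continuous_on UNIV g"
      and x: "a < x" "x < b" "strict_incr_at g x" for g x
  proof -
    obtain \<delta> where \<delta>: "0 < \<delta>" "\<And>y z. \<lbrakk>x - \<delta> < y; y < z; z < x + \<delta>\<rbrakk> \<Longrightarrow> g y < g z"
      using x(3) unfolding strict_incr_at_def by blast
    obtain b' where b': "x < b'" "b' < min b (x + \<delta>)"
      using dense[of x "min b (x + \<delta>)"] x \<delta>(1) by auto
    have "strict_mono_on {x..b'} g"
      using \<delta> b' by (intro strict_mono_onI) auto
    moreover have "continuous_on {x..b'} g" using g(2) continuous_on_subset by blast
    ultimately obtain p q where pq: "x \<le> p" "p < q" "q \<le> b'" "bi_lipschitz_on {p..q} g"
      using bi_lipschitz_somewhere[OF nB g(1), of x b'] b'(1) by blast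
    have "bi_lipschitz_on {p<..<q} g"
      by (rule bi_lipschitz_on_subset[OF pq(4)]) auto
    then have "bi_lipschitz_at g ((p + q) / 2)"
      unfolding bi_lipschitz_at_def using pq by (intro exI[of _ "{p<..<q}"]) auto
    then show ?thesis using pq x b' by (intro exI[of _ "(p + q) / 2"]) auto
  qed
  obtain x where x: "a < x" "x < b" "x \<in> monotone_set f"
    using monotone_set_dense[OF nB f cont ab] by blast
  have "dpred (\<lambda>e. e 0 = - f (e 1))"
    by (intro definable_intros definable_term_app[OF f])
  then have "strict_incr_at (\<lambda>x. - f x) x \<Longrightarrow> \<exists>y. a < y \<and> y < b \<and> bi_lipschitz_at f y"
    using incr[of "\<lambda>x. - f x" x] x cont
    by (auto simp: bi_lipschitz_at_def bi_lipschitz_on_uminus intro: continuous_on_minus)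
  then show ?thesis
    using x incr[OF f cont x(1,2)] unfolding monotone_set_def by blast
qed

end

theorem theoremE:
  fixes R :: "('f, 'r, real) fo_structure"
    and f :: "real \<Rightarrow> real"
  assumes "expands_real_order_add R"
    and "\<not> defines_B R"
    and "continuous_on UNIV f"
    and "definable_fun1 R f"
  shows "(\<exists>U. definable_set1 R U \<and> open U \<and> closure U = UNIV \<and>
            (\<forall>C\<in>components U.
               strict_mono_on C f \<or> strict_antimono_on C f \<or> f constant_on C)) \<and>
         (\<exists>V::real set. open V \<and> closure V = UNIV \<and>
            (\<forall>C\<in>components V. f constant_on C \<or> locally_bi_lipschitz_on C f))"
proof
  interpret real_group_expansion R by unfold_locales (fact assms(1))
  note f = definable_pred_fun1[OF assms(4)]
  show "\<exists>U. definable_set1 R U \<and> open U \<and> closure U = UNIV \<and>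
      (\<forall>C\<in>components U. strict_mono_on C f \<or> strict_antimono_on C f \<or> f constant_on C)"
  proof (intro exI[of _ "monotone_set f"] conjI ballI)
    show "definable_set1 R (monotone_set f)" by (rule definable_monotone_set[OF f])
    show "open (monotone_set f)" by (rule open_monotone_set)
    show "closure (monotone_set f) = UNIV"
      using monotone_set_dense[OF assms(2) f assms(3)] by (rule closure_eq_UNIV_if)
    fix C assume "C \<in> components (monotone_set f)"
    then show "strict_mono_on C f \<or> strict_antimono_on C f \<or> f constant_on C"
      using monotone_on_components[OF assms(3)] in_components_connected in_components_subset by blast
  qed
  let ?K = "{x. const_at f x}" and ?B = "{x. bi_lipschitz_at f x}"
  show "\<exists>V. open V \<and> closure V = UNIV \<and>
      (\<forall>C\<in>components V. f constant_on C \<or> locally_bi_lipschitz_on C f)"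
  proof (intro exI[of _ "?K \<union> ?B"] conjI ballI)
    show op: "open (?K \<union> ?B)" by (intro open_Un open_const_at open_bi_lipschitz_at)
    show "closure (?K \<union> ?B) = UNIV"
    proof (rule closure_eq_UNIV_if)
      fix a b :: real assume "a < b"
      then show "\<exists>x\<in>?K \<union> ?B. a < x \<and> x < b"
        using const_or_bi_lipschitz_dense[OF assms(2) f assms(3)] by blast
    qed
    fix C assume C: "C \<in> components (?K \<union> ?B)"
    then have "C \<subseteq> ?K \<or> C \<subseteq> ?B"
      using not_const_at_if_bi_lipschitz_at[of f]
      by (intro connected_in_one_of_two_open open_const_at open_bi_lipschitz_at)
         (auto dest: in_components_connected in_components_subset)
    then show "f constant_on C \<or> locally_bi_lipschitz_on C f"
    proof
      assume "C \<subseteq> ?K"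
      then show ?thesis
        using constant_on_if_locally[OF in_components_connected[OF C]] by blast
    next
      assume "C \<subseteq> ?B"
      moreover have "open C" using op C by (rule open_components)
      ultimately show ?thesis using locally_bi_lipschitz_on_if_at by blast
    qed
  qed
qed

end
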